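(* Let $N\in\mathbb{N}$ and let $t$ be any positive divisor of $N/\mathrm{rad}(N)$. Then there is an irreducible holomorphic eta quotient on $\Gamma_0(N)$ of weight $\frac12\varphi(\mathrm{rad}(N))\,\varphi(\mathrm{rad}(\gcd(t,N/t)))$. In particular, for $t=N/\mathrm{rad}(N)$ there exists an irreducible holomorphic eta quotient of level $N$ and of this weight.
   Context: Let $\eta(z)=q^{1/24}\prod_{n\ge1}(1-q^n)$, $q=e^{2\pi i z}$, $z$ in the upper half plane, and $\eta_d(z)=\eta(dz)$. An eta quotient is a finite product $\prod_d\eta_d^{X_d}$, $X_d\in\mathbb{Z}$; its level is $\operatorname{lcm}\{d:X_d\ne0\}$, its weight $\frac12\sum_dX_d$. An eta quotient on $\Gamma_0(M)$ is one whose level divides $M$. With $\mathcal{D}_M$ the set of positive divisors of $M$, each eta quotient on $\Gamma_0(M)$ is uniquely $\eta^X=\prod_{d\in\mathcal{D}_M}\eta_d^{X_d}$, and it is holomorphic (no poles at the cusps of $\Gamma_0(M)$) iff $\sum_{d\in\mathcal{D}_M}\frac{M\gcd(d,s)^2}{d\gcd(s^2,M)}X_d\ge0$ for all $s\in\mathcal{D}_M$. $f$ is factorizable on $\Gamma_0(M)$ if $f=gh$ with $g,h$ nonconstant holomorphic eta quotients on $\Gamma_0(M)$. A holomorphic eta quotient of level $L$ is irreducible if it is not factorizable on $\Gamma_0(M)$ for every multiple $M$ of $L$. $\varphi$ is Euler's totient and $\mathrm{rad}(n)$ is the product of the distinct primes dividing $n$. *)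

theory Defs
  imports "HOL-Analysis.Analysis" "HOL-Number_Theory.Totient"
begin

definition upper_half_plane :: "complex set" where
  "upper_half_plane = {z. Im z > 0}"

text \<open>The factor \<open>q\<^sup>1\<^sup>/\<^sup>2\<^sup>4\<close> means \<open>exp (2 \<pi> i z / 24)\<close>; it is not a principal power of \<open>q\<close>.\<close>

definition dedekind_eta :: "complex \<Rightarrow> complex" where
  "dedekind_eta z =
     exp (2 * of_real pi * \<i> * z / 24) *
     (\<Prod>n. 1 - exp (2 * of_real pi * \<i> * z) ^ Suc n)"

text \<open>
  An eta quotient is represented by its family of exponents \<open>X d\<close>, indexed by the positive
  integers \<open>d\<close>, with finite support. The index \<open>0\<close> only exists because of the type \<open>nat\<close> and is
  excluded. The exponents are uniquely determined by the function \<open>eta_quotient X\<close> on the upper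
  half plane, so level and weight may be read off from them; holomorphy, constancy and
  factorizations below refer to the functions themselves.
\<close>

definition eta_exponents :: "(nat \<Rightarrow> int) \<Rightarrow> bool" where
  "eta_exponents X \<longleftrightarrow> finite {d. X d \<noteq> 0} \<and> X 0 = 0"

definition eta_quotient :: "(nat \<Rightarrow> int) \<Rightarrow> complex \<Rightarrow> complex" where
  "eta_quotient X z = (\<Prod>d | X d \<noteq> 0. dedekind_eta (of_nat d * z) powi X d)"

definition eta_level :: "(nat \<Rightarrow> int) \<Rightarrow> nat" where
  "eta_level X = Lcm {d. X d \<noteq> 0}"

definition eta_weight :: "(nat \<Rightarrow> int) \<Rightarrow> real" where
  "eta_weight X = (\<Sum>d | X d \<noteq> 0. of_int (X d)) / 2"

definition eta_quotient_on_Gamma0 :: "nat \<Rightarrow> (nat \<Rightarrow> int) \<Rightarrow> bool" where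
  "eta_quotient_on_Gamma0 M X \<longleftrightarrow> eta_exponents X \<and> eta_level X dvd M"

text \<open>
  The weight-\<open>k\<close> slash operator for a matrix with rows \<open>(a, b)\<close> and \<open>(c, d)\<close>. For half-integral \<open>k\<close>
  the choice of the branch (here: principal) affects the value only by a factor of modulus one.
\<close>

definition slash ::
  "real \<Rightarrow> int \<Rightarrow> int \<Rightarrow> int \<Rightarrow> int \<Rightarrow> (complex \<Rightarrow> complex) \<Rightarrow> complex \<Rightarrow> complex" where
  "slash k a b c d f z =
     (of_int c * z + of_int d) powr of_real (- k) *
     f ((of_int a * z + of_int b) / (of_int c * z + of_int d))"

text \<open>
  Every cusp has the form \<open>\<gamma> \<infinity>\<close> with \<open>\<gamma>\<close> in \<open>SL\<^sub>2(\<int>)\<close>, and \<open>f\<close> has no pole there iff \<open>f\<close> slashed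
  with \<open>\<gamma>\<close> stays bounded as \<open>Im z\<close> tends to infinity. Quantifying over all \<open>\<gamma>\<close> covers the cusps of
  each \<open>\<Gamma>\<^sub>0(M)\<close>, so the notion does not depend on \<open>M\<close>. On the upper half plane itself eta quotients
  are always holomorphic, as \<open>\<eta>\<close> has no zeros there.
\<close>

definition no_poles_at_cusps :: "real \<Rightarrow> (complex \<Rightarrow> complex) \<Rightarrow> bool" where
  "no_poles_at_cusps k f \<longleftrightarrow>
     (\<forall>a b c d :: int. a * d - b * c = 1 \<longrightarrow> Bfun (slash k a b c d f) (filtercomap Im at_top))"

definition holomorphic_eta_quotient :: "(nat \<Rightarrow> int) \<Rightarrow> bool" where
  "holomorphic_eta_quotient X \<longleftrightarrow>
     eta_exponents X \<and> no_poles_at_cusps (eta_weight X) (eta_quotient X)"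

definition factorizable_on_Gamma0 :: "nat \<Rightarrow> (nat \<Rightarrow> int) \<Rightarrow> bool" where
  "factorizable_on_Gamma0 M X \<longleftrightarrow>
     (\<exists>Y Z.
        eta_quotient_on_Gamma0 M Y \<and> holomorphic_eta_quotient Y \<and>
        \<not> eta_quotient Y constant_on upper_half_plane \<and>
        eta_quotient_on_Gamma0 M Z \<and> holomorphic_eta_quotient Z \<and>
        \<not> eta_quotient Z constant_on upper_half_plane \<and>
        (\<forall>z\<in>upper_half_plane. eta_quotient X z = eta_quotient Y z * eta_quotient Z z))"

definition irreducible_eta_quotient :: "(nat \<Rightarrow> int) \<Rightarrow> bool" where
  "irreducible_eta_quotient X \<longleftrightarrow>
     holomorphic_eta_quotient X \<and>
     (\<forall>M>0. eta_level X dvd M \<longrightarrow> \<not> factorizable_on_Gamma0 M X)"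

definition rad :: "nat \<Rightarrow> nat" where
  "rad n = \<Prod>(prime_factors n)"

end

(*
  For exponents X the order of the eta quotient at the cusp 1/s is, up to positive factors,
  o_X(s) = sum_d X_d gcd(d,s)^2 / d, and the quotient is holomorphic at the cusps iff all o_X(s)
  are nonnegative.  This follows from the modulus of the inversion formula of eta: on the imaginary
  axis its logarithmic derivative is a transformation law of sum_k 1/sinh^2(pi k y), i.e. of a
  conditionally convergent lattice sum, and the identity theorem extends it to the half plane.

  The map X -> o_X is injective and, by primewise Abel summation, sum_d X_d is a combination of the
  o_X(s) with positive coefficients; so the weight of a holomorphic eta quotient is nonnegative and
  vanishes only for the trivial one.

  Let X be the tensor product over the primes p dividing N of the exponents (p, -1) (if p does not
  divide t) or (-p, p^2+1, -p) around p^j, j = v_p(t).  It is holomorphic, vanishing at the cusps 1/s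
  with v_p(s) = j for all p | N only.  If it equals g h, then g and h vanish at no other cusps, which
  forces their exponents to be an integral multiple of the same local vector at every p | N
  (as j < v_p(N), nothing changes at higher levels).  Hence the weights of g and h are
  nonnegative integral multiples of the weight of X and add up to it: one of them is 0.
*)
theory Submission
  imports Defs "HOL-Complex_Analysis.Complex_Analysis"
begin

text \<open>Holomorphy is a growth condition on functions and a factorization is an identity of
  functions, so the orders have to be recovered from analytic data. Moduli suffice for this:
  \<open>norm (dedekind_eta z) ^ 4 * Im z\<close> is invariant under the full modular group, which
  avoids the roots of unity and square roots in the transformation law of eta. The obstacle in the
  inversion formula is that the sum of the real parts of 1/(k y + i n)^2 does not converge
  absolutely: its two iterated sums differ by pi / (2 y), and this defect produces the factor
  \<open>norm z\<close>. The local vectors come from the rows p^(2 min(i,k) - i) of the order matrix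
  at p. Each row is geometric in i with ratio p up to k and ratio 1/p from k on; (-p, p^2 + 1, -p)
  annihilates both progressions, its characteristic roots being p and 1/p, and only feels the kink
  at k = j. The multiples of these vectors found in a factor are integral because the vectors are
  primitive: (p, -1) has a unit entry, and (p^2 + 1) - p * p = 1.\<close>

section \<open>A conditionally convergent lattice sum\<close>

text \<open>A product bound makes the family absolutely summable over pairs. This serves both the
  absolutely convergent correction to the lattice sum and the Lambert series of eta.\<close>

lemma sums_swap_dominated:
  fixes f :: "nat \<Rightarrow> nat \<Rightarrow> real"
  assumes bound: "\<And>m n. \<bar>f m n\<bar> \<le> a m * b n"
    and a: "summable a" "\<And>m. 0 \<le> a m" and b: "summable b" "\<And>n. 0 \<le> b n"
  obtains s where "(\<lambda>m. \<Sum>n. f m n) sums s" "(\<lambda>n. \<Sum>m. f m n) sums s"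
proof -
  have aS: "a summable_on UNIV" and bS: "b summable_on UNIV"
    using a b by (auto intro: summable_nonneg_imp_summable_on)
  have "(\<lambda>(m, n). a m * b n) summable_on (UNIV \<times> UNIV)"
    using aS bS a b by (intro summable_on_SigmaI[where g = "\<lambda>m. a m * infsum b UNIV"])
      (auto intro!: has_sum_cmult_right summable_on_cmult_left has_sum_infsum)
  hence fS: "(\<lambda>(m, n). f m n) summable_on (UNIV \<times> UNIV)"
    by (rule Infinite_Sum.abs_summable_summable[OF Infinite_Sum.abs_summable_on_comparison_test'])
       (use bound in auto)
  have row: "summable (\<lambda>n. norm (f m n))" for m
    by (rule summable_comparison_test'[OF summable_mult[OF b(1), of "a m"], of 0]) (use bound in auto)
  have col: "summable (\<lambda>m. norm (f m n))" for n
    by (rule summable_comparison_test'[OF summable_mult2[OF a(1), of "b n"], of 0]) (use bound in auto)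
  have row_sum: "infsum (f m) UNIV = (\<Sum>n. f m n)" for m
    by (rule infsumI, rule norm_summable_imp_has_sum[OF row], rule summable_sums[OF summable_norm_cancel[OF row]])
  have col_sum: "infsum (\<lambda>m. f m n) UNIV = (\<Sum>m. f m n)" for n
    by (rule infsumI, rule norm_summable_imp_has_sum[OF col], rule summable_sums[OF summable_norm_cancel[OF col]])
  have "(\<lambda>(n, m). f m n) summable_on (UNIV \<times> UNIV)"
    using fS by (subst summable_on_swap) (simp add: case_prod_unfold)
  from infsum_swap_banach[OF fS] summable_on_Sigma_banach[OF fS] summable_on_Sigma_banach[OF this]
  have "((\<lambda>m. \<Sum>n. f m n) has_sum (\<Sum>\<^sub>\<infinity>m. \<Sum>n. f m n)) UNIV" "((\<lambda>n. \<Sum>m. f m n) has_sum (\<Sum>\<^sub>\<infinity>m. \<Sum>n. f m n)) UNIV"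
    by (simp_all only: row_sum col_sum summable_iff_has_sum_infsum)
  thus thesis using that by (blast dest: has_sum_imp_sums)
qed

text \<open>The real part of 1/(a + i b)^2. Summed over a = k y and b = n it is an Eisenstein sum of
  weight 2, just too large for absolute convergence.\<close>

definition lattice_kernel :: "real \<Rightarrow> real \<Rightarrow> real" where
  "lattice_kernel a b = (a\<^sup>2 - b\<^sup>2) / (a\<^sup>2 + b\<^sup>2)\<^sup>2"

lemma lattice_kernel_conv_Re: "lattice_kernel a b = Re (1 / (Complex a b)\<^sup>2)"
proof (cases "a = 0 \<and> b = 0")
  case False
  have "a\<^sup>2 + b\<^sup>2 \<noteq> 0" using False by (simp add: sum_power2_eq_zero_iff)
  have "Re (1 / (Complex a b)\<^sup>2) = (a\<^sup>2 - b\<^sup>2) / ((a\<^sup>2 - b\<^sup>2)\<^sup>2 + (2 * a * b)\<^sup>2)"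
    by (simp add: Re_divide power2_eq_square)
  also have "(a\<^sup>2 - b\<^sup>2)\<^sup>2 + (2 * a * b)\<^sup>2 = (a\<^sup>2 + b\<^sup>2)\<^sup>2"
    by (simp add: power2_eq_square algebra_simps)
  finally show ?thesis by (simp add: lattice_kernel_def)
\<comment> \<open>At the origin both sides are 0 because division by 0 yields 0.\<close>
qed (simp add: lattice_kernel_def flip: zero_complex.code)

text \<open>Differences of 1/w^2 decay like |w|^(-3), one order better than the kernel. Replacing
  |w|^3 by (a b)^(3/2) separates the variables, and the exponent 3/2 > 1 keeps both resulting series
  summable.\<close>

lemma lattice_kernel_diff_bound:
  assumes "0 < a" "a \<le> a'" "0 < b" "b \<le> b'"
  shows "\<bar>lattice_kernel a' b' - lattice_kernel a b\<bar> \<le> 2 * ((a' - a) + (b' - b)) / (a * b) powr (3/2)"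
proof -
  define w where "w = Complex a b"
  define v where "v = Complex a' b'"
  have nz: "w \<noteq> 0" "v \<noteq> 0" using assms by (auto simp: w_def v_def complex_eq_iff)
  have wv: "norm w \<le> norm v"
    using assms by (auto simp: w_def v_def complex_norm intro!: add_mono power_mono)
  have "norm (v - w) \<le> \<bar>Re (v - w)\<bar> + \<bar>Im (v - w)\<bar>" by (rule cmod_le)
  hence d: "norm (v - w) \<le> (a' - a) + (b' - b)" using assms by (simp add: v_def w_def)
  have "\<bar>lattice_kernel a' b' - lattice_kernel a b\<bar> = \<bar>Re (1 / v\<^sup>2 - 1 / w\<^sup>2)\<bar>"
    by (simp add: lattice_kernel_conv_Re v_def w_def)
  also have "\<dots> \<le> norm (1 / v\<^sup>2 - 1 / w\<^sup>2)" by (rule abs_Re_le_cmod)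
  also have "1 / v\<^sup>2 - 1 / w\<^sup>2 = - ((v - w) * (v + w)) / (v\<^sup>2 * w\<^sup>2)"
    using nz by (simp add: field_simps power2_eq_square)
  also have "norm \<dots> = norm (v - w) * norm (v + w) / ((norm v)\<^sup>2 * (norm w)\<^sup>2)"
    by (simp only: norm_divide norm_minus_cancel norm_mult norm_power)
  also have "\<dots> \<le> norm (v - w) * (2 * norm v) / ((norm v)\<^sup>2 * (norm w)\<^sup>2)"
    using norm_triangle_ineq[of v w] wv
    by (intro divide_right_mono mult_left_mono) auto
  also have "\<dots> = 2 * norm (v - w) / (norm v * (norm w)\<^sup>2)"
    using nz by (simp add: power2_eq_square)
  also have "\<dots> \<le> 2 * norm (v - w) / (norm w * (norm w)\<^sup>2)"
    using nz wv by (intro divide_left_mono mult_right_mono mult_pos_pos) auto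
  also have "\<dots> \<le> 2 * ((a' - a) + (b' - b)) / (norm w * (norm w)\<^sup>2)"
    using d by (intro divide_right_mono mult_left_mono) auto
  also have "\<dots> \<le> 2 * ((a' - a) + (b' - b)) / (a * b) powr (3/2)"
  proof -
    have "a * b \<le> (norm w)\<^sup>2"
      using sum_squares_bound[of a b] mult_pos_pos[OF assms(1,3)] by (simp add: w_def cmod_power2)
    hence "(a * b) powr (3/2) \<le> ((norm w)\<^sup>2) powr (3/2)"
      using assms by (intro powr_mono2) auto
    also have "(norm w)\<^sup>2 = norm w powr 2" using nz by simp
    also have "(norm w powr 2) powr (3/2) = norm w powr 3" by (subst powr_powr) simp
    also have "\<dots> = norm w * (norm w)\<^sup>2"
      using nz by (simp add: power3_eq_cube power2_eq_square)
    finally show ?thesis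
      using assms nz by (intro divide_left_mono mult_pos_pos) auto
  qed
  finally show ?thesis .
qed

text \<open>The mixed derivative of arctan (x y / v) in x and v is
  \<open>y * lattice_kernel (x * y) v\<close>. Two applications of the mean value theorem, first in
  x and then in v, express the second difference over a unit square by one value of it.\<close>

lemma lattice_kernel_eq_second_difference:
  assumes "y > 0" "k > 0" "n > 0"
  obtains \<xi> \<nu> where "k < \<xi>" "\<xi> < k + 1" "n < \<nu>" "\<nu> < n + 1"
    "arctan ((k+1) * y / (n+1)) - arctan (k * y / (n+1)) -
     (arctan ((k+1) * y / n) - arctan (k * y / n)) = y * lattice_kernel (\<xi> * y) \<nu>"
proof -
  have d1: "((\<lambda>x. arctan (x * y / v)) has_real_derivative y * v / (v\<^sup>2 + x\<^sup>2 * y\<^sup>2)) (at x)"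
    if "v > 0" for x v :: real
    using that by (auto intro!: derivative_eq_intros simp: field_simps power2_eq_square add_pos_nonneg)
  have d2: "((\<lambda>v. y * v / (v\<^sup>2 + x\<^sup>2 * y\<^sup>2)) has_real_derivative y * lattice_kernel (x * y) v) (at v)"
    if "v > 0" for x v :: real
  proof -
    have "v\<^sup>2 + x\<^sup>2 * y\<^sup>2 > 0" using that by (intro add_pos_nonneg) auto
    thus ?thesis
      by (auto intro!: derivative_eq_intros simp: lattice_kernel_def power_mult_distrib)
         (simp add: field_simps power2_eq_square)
  qed
  have "\<exists>\<xi>>k. \<xi> < k + 1 \<and>
    (arctan ((k+1) * y / (n+1)) - arctan ((k+1) * y / n)) - (arctan (k * y / (n+1)) - arctan (k * y / n)) =
    (k + 1 - k) * (y * (n+1) / ((n+1)\<^sup>2 + \<xi>\<^sup>2 * y\<^sup>2) - y * n / (n\<^sup>2 + \<xi>\<^sup>2 * y\<^sup>2))"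
    using assms by (intro MVT2 DERIV_diff d1) auto
  then obtain \<xi> where \<xi>: "k < \<xi>" "\<xi> < k + 1"
    "(arctan ((k+1) * y / (n+1)) - arctan ((k+1) * y / n)) - (arctan (k * y / (n+1)) - arctan (k * y / n)) =
     y * (n+1) / ((n+1)\<^sup>2 + \<xi>\<^sup>2 * y\<^sup>2) - y * n / (n\<^sup>2 + \<xi>\<^sup>2 * y\<^sup>2)" by auto
  have "\<exists>\<nu>>n. \<nu> < n + 1 \<and> y * (n+1) / ((n+1)\<^sup>2 + \<xi>\<^sup>2 * y\<^sup>2) - y * n / (n\<^sup>2 + \<xi>\<^sup>2 * y\<^sup>2) =
     (n + 1 - n) * (y * lattice_kernel (\<xi> * y) \<nu>)"
    using assms by (intro MVT2 d2) auto
  then obtain \<nu> where \<nu>: "n < \<nu>" "\<nu> < n + 1"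
    "y * (n+1) / ((n+1)\<^sup>2 + \<xi>\<^sup>2 * y\<^sup>2) - y * n / (n\<^sup>2 + \<xi>\<^sup>2 * y\<^sup>2) = y * lattice_kernel (\<xi> * y) \<nu>" by auto
  show thesis using \<xi> \<nu> by (intro that[of \<xi> \<nu>]) auto
qed

lemma abs_lattice_kernel_le: "\<bar>lattice_kernel a b\<bar> \<le> 1 / (a\<^sup>2 + b\<^sup>2)"
proof (cases "a\<^sup>2 + b\<^sup>2 = 0")
  case False
  hence pos: "a\<^sup>2 + b\<^sup>2 > 0" by (simp add: less_le)
  have "\<bar>lattice_kernel a b\<bar> = \<bar>a\<^sup>2 - b\<^sup>2\<bar> / (a\<^sup>2 + b\<^sup>2)\<^sup>2" by (simp add: lattice_kernel_def)
  also have "\<dots> \<le> (a\<^sup>2 + b\<^sup>2) / (a\<^sup>2 + b\<^sup>2)\<^sup>2"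
    using zero_le_power2[of a] zero_le_power2[of b] by (intro divide_right_mono) (auto simp: abs_le_iff)
  also have "\<dots> = 1 / (a\<^sup>2 + b\<^sup>2)" using pos by (simp add: power2_eq_square)
  finally show ?thesis .
qed (simp add: lattice_kernel_def)

lemma summable_inverse_Suc_squares: "summable (\<lambda>n. 1 / (real (Suc n))\<^sup>2)"
  using inverse_squares_sums by (auto simp: sums_iff add.commute)

lemma summable_lattice_kernel:
  assumes "y > 0"
  shows "summable (\<lambda>n. lattice_kernel a (real (Suc n)))" "summable (\<lambda>k. lattice_kernel (real (Suc k) * y) b)"
proof -
  show "summable (\<lambda>n. lattice_kernel a (real (Suc n)))"
  proof (rule summable_comparison_test'[OF summable_inverse_Suc_squares, of 0])
    fix n
    have "norm (lattice_kernel a (real (Suc n))) \<le> 1 / (a\<^sup>2 + (real (Suc n))\<^sup>2)"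
      using abs_lattice_kernel_le by simp
    also have "\<dots> \<le> 1 / (real (Suc n))\<^sup>2"
      by (intro divide_left_mono mult_pos_pos add_nonneg_pos) auto
    finally show "norm (lattice_kernel a (real (Suc n))) \<le> 1 / (real (Suc n))\<^sup>2" .
  qed
  have "summable (\<lambda>k. 1 / y\<^sup>2 * (1 / (real (Suc k))\<^sup>2))"
    by (intro summable_mult summable_inverse_Suc_squares)
  thus "summable (\<lambda>k. lattice_kernel (real (Suc k) * y) b)"
  proof (rule summable_comparison_test'[of _ 0])
    fix k
    have "norm (lattice_kernel (real (Suc k) * y) b) \<le> 1 / ((real (Suc k) * y)\<^sup>2 + b\<^sup>2)"
      using abs_lattice_kernel_le by simp
    also have "\<dots> \<le> 1 / (real (Suc k) * y)\<^sup>2"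
      using assms by (intro divide_left_mono mult_pos_pos add_pos_nonneg) auto
    finally show "norm (lattice_kernel (real (Suc k) * y) b) \<le> 1 / y\<^sup>2 * (1 / (real (Suc k))\<^sup>2)"
      by (simp add: power_mult_distrib mult.commute)
  qed
qed

lemma arctan_mult_Suc_tendsto:
  assumes "c > 0"
  shows "(\<lambda>k. arctan (real (Suc k) * c)) \<longlonglongrightarrow> pi / 2"
  by (rule filterlim_compose[OF tendsto_arctan_at_top], rule filterlim_at_top_mult_tendsto_pos[OF tendsto_const assms],
      rule filterlim_compose[OF filterlim_real_sequentially filterlim_Suc])

lemma arctan_divide_Suc_tendsto: "(\<lambda>n. arctan (c / real (Suc n))) \<longlonglongrightarrow> 0"
proof -
  have "(\<lambda>n. c / real (Suc n)) \<longlonglongrightarrow> 0"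
    by (rule LIMSEQ_Suc) (rule lim_const_over_n)
  from tendsto_arctan[OF this] show ?thesis by simp
qed

text \<open>
  The summand \<open>lattice_kernel\<close> is \<open>1 / y\<close> times a mixed second derivative of the arctangent. Replacing it by
  the corresponding second difference changes the double series by an absolutely convergent one,
  and for the second differences both iterated sums telescope.
\<close>

lemma lattice_kernel_iterated_sums:
  assumes y: "y > 0"
  obtains A where "(\<lambda>k. \<Sum>n. lattice_kernel (real (Suc k) * y) (real (Suc n))) sums A"
    "(\<lambda>n. \<Sum>k. lattice_kernel (real (Suc k) * y) (real (Suc n))) sums (A + pi / (2 * y))"
proof -
  define \<theta> where "\<theta> k n = arctan (real (Suc k) * y / real (Suc n))" for k n
  define g where "g k n = lattice_kernel (real (Suc k) * y) (real (Suc n))" for k n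
  define h where "h k n = (\<theta> (Suc k) (Suc n) - \<theta> k (Suc n) - (\<theta> (Suc k) n - \<theta> k n)) / y" for k n
  define c where "c k = real (Suc k) powr (-3/2)" for k
  have c: "summable c"
  proof -
    have "summable (\<lambda>k. real k powr (-3/2))" by (subst summable_real_powr_iff) simp
    thus ?thesis unfolding c_def by (subst summable_Suc_iff[of "\<lambda>k. real k powr (-3/2)"])
  qed
  \<comment> \<open>The constant is the one of \<open>lattice_kernel_diff_bound\<close>: the two
    arguments move by at most y and 1 inside a unit square, and y ^ (3/2) splits off the product of
    the arguments.\<close>
  define a where "a k = 2 * (1 + y) / y powr (3/2) * c k" for k
  have bound: "\<bar>h k n - g k n\<bar> \<le> a k * c n" for k n
  proof -
    obtain \<xi> \<nu> where *: "real (Suc k) < \<xi>" "\<xi> < real (Suc k) + 1" "real (Suc n) < \<nu>" "\<nu> < real (Suc n) + 1"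
      "arctan ((real (Suc k)+1) * y / (real (Suc n)+1)) - arctan (real (Suc k) * y / (real (Suc n)+1)) -
       (arctan ((real (Suc k)+1) * y / real (Suc n)) - arctan (real (Suc k) * y / real (Suc n))) = y * lattice_kernel (\<xi> * y) \<nu>"
      using lattice_kernel_eq_second_difference[OF y, of "real (Suc k)" "real (Suc n)"] by auto
    have "h k n = lattice_kernel (\<xi> * y) \<nu>"
      using *(5) y by (simp add: h_def \<theta>_def field_simps add_ac)
    hence "\<bar>h k n - g k n\<bar> \<le> 2 * ((\<xi> * y - real (Suc k) * y) + (\<nu> - real (Suc n))) / (real (Suc k) * y * real (Suc n)) powr (3/2)"
      using lattice_kernel_diff_bound[of "real (Suc k) * y" "\<xi> * y" "real (Suc n)" \<nu>] * y by (simp add: g_def)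
    also have "\<dots> \<le> 2 * (1 + y) / (real (Suc k) * y * real (Suc n)) powr (3/2)"
    proof -
      have "(\<xi> - real (Suc k)) * y \<le> 1 * y" using * y by (intro mult_right_mono) auto
      thus ?thesis using * by (intro divide_right_mono mult_left_mono) (auto simp: algebra_simps)
    qed
    also have "\<dots> = a k * c n"
      using y by (simp add: a_def c_def powr_mult powr_minus field_simps del: of_nat_Suc)
    finally show ?thesis .
  qed
  have a: "summable a" unfolding a_def by (intro summable_mult c)
  have nonneg: "0 \<le> a k" "0 \<le> c k" for k using y by (auto simp: a_def c_def)
  obtain D where D: "(\<lambda>k. \<Sum>n. h k n - g k n) sums D" "(\<lambda>n. \<Sum>k. h k n - g k n) sums D"
    using sums_swap_dominated[of "\<lambda>k n. h k n - g k n" a c, OF bound a nonneg(1) c nonneg(2)] by blast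
  have \<theta>n: "\<theta> k \<longlonglongrightarrow> 0" for k
    unfolding \<theta>_def by (rule arctan_divide_Suc_tendsto)
  have \<theta>k: "(\<lambda>k. \<theta> k n) \<longlonglongrightarrow> pi / 2" for n
    using arctan_mult_Suc_tendsto[of "y / real (Suc n)"] y unfolding \<theta>_def by simp
  have h1: "(\<lambda>n. h k n) sums (- (\<theta> (Suc k) 0 - \<theta> k 0) / y)" for k
  proof -
    have "(\<lambda>n. (\<theta> (Suc k) (Suc n) - \<theta> k (Suc n)) - (\<theta> (Suc k) n - \<theta> k n)) sums ((0 - 0) - (\<theta> (Suc k) 0 - \<theta> k 0))"
      by (intro telescope_sums tendsto_diff \<theta>n)
    from sums_divide[OF this, of y] show ?thesis by (simp add: h_def)
  qed
  have h2: "(\<lambda>k. h k n) sums (- (\<theta> 0 (Suc n) - \<theta> 0 n) / y)" for n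
  proof -
    have "(\<lambda>k. (\<theta> (Suc k) (Suc n) - \<theta> (Suc k) n) - (\<theta> k (Suc n) - \<theta> k n)) sums ((pi/2 - pi/2) - (\<theta> 0 (Suc n) - \<theta> 0 n))"
      by (intro telescope_sums tendsto_diff \<theta>k)
    from sums_divide[OF this, of y] show ?thesis by (simp add: h_def algebra_simps)
  qed
  \<comment> \<open>Here Fubini fails: \<open>\<theta>\<close> tends to pi / 2 as k grows but to 0
    as n grows. The telescoped values \<open>H1\<close> and \<open>H2\<close> therefore differ by pi
    / (2 * y), and the correction \<open>D\<close> is the same in both orders.\<close>
  have H1: "(\<lambda>k. \<Sum>n. h k n) sums (- (pi / 2 - \<theta> 0 0) / y)"
  proof -
    have "(\<lambda>k. \<theta> (Suc k) 0 - \<theta> k 0) sums (pi / 2 - \<theta> 0 0)" by (intro telescope_sums \<theta>k)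
    from sums_divide[OF sums_minus[OF this], of y] show ?thesis using h1 by (simp add: sums_iff)
  qed
  have H2: "(\<lambda>n. \<Sum>k. h k n) sums (- (0 - \<theta> 0 0) / y)"
  proof -
    have "(\<lambda>n. \<theta> 0 (Suc n) - \<theta> 0 n) sums (0 - \<theta> 0 0)" by (intro telescope_sums \<theta>n)
    from sums_divide[OF sums_minus[OF this], of y] show ?thesis using h2 by (simp add: sums_iff)
  qed
  have G1: "(\<Sum>n. h k n) - (\<Sum>n. h k n - g k n) = (\<Sum>n. g k n)" for k
  proof -
    have "summable (g k)" using summable_lattice_kernel(1)[OF y] by (simp add: g_def[abs_def])
    thus ?thesis using suminf_diff[OF sums_summable[OF h1[of k]], of "g k"] by simp
  qed
  have G2: "(\<Sum>k. h k n) - (\<Sum>k. h k n - g k n) = (\<Sum>k. g k n)" for n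
    using suminf_diff[of "\<lambda>k. h k n" "\<lambda>k. g k n"] sums_summable[OF h2[of n]] summable_lattice_kernel(2)[OF y, of "real (Suc n)"]
    by (simp add: g_def)
  have "(\<lambda>k. \<Sum>n. g k n) sums (- (pi / 2 - \<theta> 0 0) / y - D)"
    using sums_diff[OF H1 D(1)] by (simp add: G1)
  moreover have "(\<lambda>n. \<Sum>k. g k n) sums (- (0 - \<theta> 0 0) / y - D)"
    using sums_diff[OF H2 D(2)] by (simp add: G2)
  moreover have "- (0 - \<theta> 0 0) / y - D = (- (pi / 2 - \<theta> 0 0) / y - D) + pi / (2 * y)"
    using y by (simp add: field_simps)
  ultimately show thesis using that[of "- (pi / 2 - \<theta> 0 0) / y - D"] unfolding g_def by (simp only:)
qed

section \<open>Partial fractions of the inverse squared sine, and the sum of 1/sinh^2 under y ->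
  1/y\<close>

text \<open>The logarithmic derivative of the reflection formula of Gamma is the cotangent formula
  for Digamma; differentiating once more gives the claim. Since Polygamma 1 is a series of inverse
  squares, this is the partial fraction expansion of pi^2 / sin^2.\<close>

lemma Polygamma_1_reflection:
  fixes z :: complex
  assumes z: "z \<notin> \<int>"
  shows "Polygamma 1 z + Polygamma 1 (1 - z) = (of_real pi)\<^sup>2 / (sin (of_real pi * z))\<^sup>2"
proof -
  have open_nonint: "open (- \<int> :: complex set)"
    using closed_Ints by (simp add: open_Compl)
  have nz: "sin (of_real pi * w) \<noteq> 0" if "w \<notin> \<int>" for w :: complex
    using that by (auto simp: sin_eq_0)
  have nonpos: "w \<notin> \<int>\<^sub>\<le>\<^sub>0" "1 - w \<notin> \<int>\<^sub>\<le>\<^sub>0" if "w \<notin> \<int>" for w :: complex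
    using that nonpos_Ints_Int Ints_diff[of 1 "1 - w"] by auto
  have cot: "Digamma w - Digamma (1 - w) = - (of_real pi * cos (of_real pi * w) / sin (of_real pi * w))"
    if w: "w \<notin> \<int>" for w :: complex
  proof -
    have "((\<lambda>w. Gamma w * Gamma (1 - w)) has_field_derivative
             (Gamma w * Digamma w) * Gamma (1 - w) + Gamma w * - (Gamma (1 - w) * Digamma (1 - w))) (at w)"
      using nonpos[OF w] by (auto intro!: derivative_eq_intros)
    moreover have "((\<lambda>w. of_real pi / sin (of_real pi * w)) has_field_derivative
             - (of_real pi * (of_real pi * cos (of_real pi * w)) / (sin (of_real pi * w))\<^sup>2)) (at w)"
      using nz[OF w] by (auto intro!: derivative_eq_intros simp: power2_eq_square)
    ultimately have "(Gamma w * Digamma w) * Gamma (1 - w) + Gamma w * - (Gamma (1 - w) * Digamma (1 - w)) =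
        - (of_real pi * (of_real pi * cos (of_real pi * w)) / (sin (of_real pi * w))\<^sup>2)"
      unfolding Gamma_reflection_complex by (rule DERIV_unique)
    hence "(Gamma w * Gamma (1 - w)) * (Digamma w - Digamma (1 - w)) =
        - (of_real pi * (of_real pi * cos (of_real pi * w)) / (sin (of_real pi * w))\<^sup>2)"
      by (simp add: algebra_simps)
    thus ?thesis
      unfolding Gamma_reflection_complex using nz[OF w]
      by (subst mult_left_cancel[of "of_real pi / sin (of_real pi * w)", symmetric]) (auto simp: power2_eq_square)
  qed
  have "((\<lambda>w. Digamma w - Digamma (1 - w)) has_field_derivative Polygamma 1 z + Polygamma 1 (1 - z)) (at z)"
    using nonpos[OF z] by (auto intro!: derivative_eq_intros)
  moreover have "((\<lambda>w. - (of_real pi * cos (of_real pi * w) / sin (of_real pi * w))) has_field_derivative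
      (of_real pi)\<^sup>2 * ((sin (of_real pi * z))\<^sup>2 + (cos (of_real pi * z))\<^sup>2) / (sin (of_real pi * z))\<^sup>2) (at z)"
  proof -
    have "- ((- (of_real pi * (of_real pi * (s * s))) - of_real pi * (of_real pi * (c * c))) / (s * s)) =
        (of_real pi)\<^sup>2 * (s\<^sup>2 + c\<^sup>2) / s\<^sup>2" if "s \<noteq> 0" for s c :: complex
      using that by (simp add: field_simps power2_eq_square)
    from this[OF nz[OF z], of "cos (of_real pi * z)", symmetric] show ?thesis
      using nz[OF z] by (auto intro!: derivative_eq_intros simp: mult_ac)
  qed
  hence "((\<lambda>w. Digamma w - Digamma (1 - w)) has_field_derivative
      (of_real pi)\<^sup>2 * ((sin (of_real pi * z))\<^sup>2 + (cos (of_real pi * z))\<^sup>2) / (sin (of_real pi * z))\<^sup>2) (at z)"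
    by (rule has_field_derivative_transform_within_open[OF _ open_nonint]) (use z cot in auto)
  ultimately show ?thesis by (auto dest: DERIV_unique)
qed

text \<open>The expansion of pi^2 / sin^2 at z = i t. The term at 0 splits off as 1 / t^2, and the
  terms at n and -n have the same real part, whence the division by 2. The kernel changes sign when
  its arguments are swapped, which cancels the sign from sin (i x) = i sinh x.\<close>

lemma inverse_sinh_squared_sums:
  assumes t: "t > 0"
  shows "(\<lambda>n. lattice_kernel t (real (Suc n))) sums ((pi\<^sup>2 / (sinh (pi * t))\<^sup>2 - 1 / t\<^sup>2) / 2)"
proof -
  define z where "z = \<i> * complex_of_real t"
  have z: "z \<notin> \<int>"
    using t by (auto simp: z_def complex_is_Int_iff)
  have z': "z \<noteq> 0" "1 - z \<noteq> 0" using t by (auto simp: z_def complex_eq_iff)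
  have "(\<lambda>k. inverse ((z + of_nat k)\<^sup>2)) sums Polygamma 1 z"
    using Polygamma_LIMSEQ[of z 1] z' by (simp add: numeral_2_eq_2)
  hence "(\<lambda>k. inverse ((z + of_nat (Suc k))\<^sup>2)) sums (Polygamma 1 z - inverse (z\<^sup>2))"
    by (subst sums_Suc_iff) simp
  moreover have "(\<lambda>k. inverse ((1 - z + of_nat k)\<^sup>2)) sums Polygamma 1 (1 - z)"
    using Polygamma_LIMSEQ[of "1 - z" 1] z' by (simp add: numeral_2_eq_2)
  ultimately have "(\<lambda>k. inverse ((z + of_nat (Suc k))\<^sup>2) + inverse ((1 - z + of_nat k)\<^sup>2)) sums
      (Polygamma 1 z - inverse (z\<^sup>2) + Polygamma 1 (1 - z))"
    by (rule sums_add)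
  also have "Polygamma 1 z - inverse (z\<^sup>2) + Polygamma 1 (1 - z) = (of_real pi)\<^sup>2 / (sin (of_real pi * z))\<^sup>2 - inverse (z\<^sup>2)"
    using Polygamma_1_reflection[OF z] by (simp add: algebra_simps)
  also have "sin (of_real pi * z) = \<i> * of_real (sinh (pi * t))"
    by (simp add: z_def sin_i_times mult.left_commute[of _ \<i>] sinh_def exp_of_real scaleR_conv_of_real exp_minus
        flip: of_real_mult)
  also have "(of_real pi)\<^sup>2 / (\<i> * of_real (sinh (pi * t)))\<^sup>2 - inverse (z\<^sup>2) =
     complex_of_real (- (pi\<^sup>2 / (sinh (pi * t))\<^sup>2) + 1 / t\<^sup>2)"
    by (simp add: z_def power_mult_distrib field_simps)
  finally have "(\<lambda>k. Re (inverse ((z + of_nat (Suc k))\<^sup>2) + inverse ((1 - z + of_nat k)\<^sup>2))) sums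
      (- (pi\<^sup>2 / (sinh (pi * t))\<^sup>2) + 1 / t\<^sup>2)"
    using sums_Re by fastforce
  also have "(\<lambda>k. Re (inverse ((z + of_nat (Suc k))\<^sup>2) + inverse ((1 - z + of_nat k)\<^sup>2))) =
      (\<lambda>k. - 2 * lattice_kernel t (real (Suc k)))"
  proof
    fix k
    have "z + of_nat (Suc k) = Complex (real (Suc k)) t" "1 - z + of_nat k = Complex (real (Suc k)) (-t)"
      by (auto simp: z_def complex_eq_iff)
    moreover have "lattice_kernel (real (Suc k)) t = - lattice_kernel t (real (Suc k))" "lattice_kernel (real (Suc k)) (-t) = - lattice_kernel t (real (Suc k))"
      by (simp_all add: lattice_kernel_def add.commute minus_divide_left del: divide_minus_left)
    ultimately show "Re (inverse ((z + of_nat (Suc k))\<^sup>2) + inverse ((1 - z + of_nat k)\<^sup>2)) = - 2 * lattice_kernel t (real (Suc k))"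
      using lattice_kernel_conv_Re[of "real (Suc k)" t] lattice_kernel_conv_Re[of "real (Suc k)" "-t"]
      by (simp add: inverse_eq_divide)
  qed
  finally have *: "(\<lambda>k. - 2 * lattice_kernel t (real (Suc k))) sums (- (pi\<^sup>2 / (sinh (pi * t))\<^sup>2) + 1 / t\<^sup>2)" .
  have "(- P + Q) / (-2) = (P - Q) / 2" for P Q :: real by (simp add: field_simps)
  moreover have "(\<lambda>k. - 2 * lattice_kernel t (real (Suc k)) / (-2)) = (\<lambda>k. lattice_kernel t (real (Suc k)))" by simp
  ultimately show ?thesis using sums_divide[OF *, of "- 2"] by (simp only:)
qed

text \<open>With q = exp (-2 pi y) this is 4 pi^2 times the sum of sigma(n) q^n, so 1 - 6 * csch_sum
  y / pi^2 is the Eisenstein series E_2 at i y.\<close>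

definition csch_sum :: "real \<Rightarrow> real" where
  "csch_sum y = (\<Sum>k. pi\<^sup>2 / (sinh (pi * (real (Suc k) * y)))\<^sup>2)"

lemma csch_sum_sums:
  assumes y: "y > 0" and A: "(\<lambda>k. \<Sum>n. lattice_kernel (real (Suc k) * y) (real (Suc n))) sums A"
  shows "(\<lambda>k. pi\<^sup>2 / (sinh (pi * (real (Suc k) * y)))\<^sup>2) sums (2 * A + pi\<^sup>2 / 6 / y\<^sup>2)"
proof -
  have "(\<lambda>k. 1 / (real (Suc k))\<^sup>2 / y\<^sup>2) sums (pi\<^sup>2 / 6 / y\<^sup>2)"
    using inverse_squares_sums by (intro sums_divide) (simp add: add.commute)
  from sums_add[OF sums_mult[OF A, of 2] this]
  have "(\<lambda>k. 2 * (\<Sum>n. lattice_kernel (real (Suc k) * y) (real (Suc n))) + 1 / (real (Suc k))\<^sup>2 / y\<^sup>2) sums (2 * A + pi\<^sup>2 / 6 / y\<^sup>2)" .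
  moreover have "2 * (\<Sum>n. lattice_kernel (real (Suc k) * y) (real (Suc n))) + 1 / (real (Suc k))\<^sup>2 / y\<^sup>2 =
     pi\<^sup>2 / (sinh (pi * (real (Suc k) * y)))\<^sup>2" for k
  proof -
    have "(\<Sum>n. lattice_kernel (real (Suc k) * y) (real (Suc n))) = (pi\<^sup>2 / (sinh (pi * (real (Suc k) * y)))\<^sup>2 - 1 / (real (Suc k) * y)\<^sup>2) / 2"
      using inverse_sinh_squared_sums[of "real (Suc k) * y"] y by (simp add: sums_iff)
    thus ?thesis by (simp add: power_mult_distrib)
  qed
  ultimately show ?thesis by simp
qed

lemma csch_sum_summable:
  assumes "y > 0"
  shows "summable (\<lambda>k. pi\<^sup>2 / (sinh (pi * (real (Suc k) * y)))\<^sup>2)"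
  using lattice_kernel_iterated_sums[OF assms] csch_sum_sums[OF assms] sums_summable by metis

text \<open>The kernel is homogeneous of degree -2 and antisymmetric, so replacing y by 1 / y
  interchanges the order of summation up to the factor -y^2. The discrepancy pi / (2 y) of the two
  orders becomes the term - pi * y.\<close>

lemma csch_sum_inversion:
  assumes y: "y > 0"
  shows "csch_sum (1 / y) + y\<^sup>2 * csch_sum y = pi\<^sup>2 / 6 * (1 + y\<^sup>2) - pi * y"
proof -
  obtain A where A: "(\<lambda>k. \<Sum>n. lattice_kernel (real (Suc k) * y) (real (Suc n))) sums A"
    "(\<lambda>n. \<Sum>k. lattice_kernel (real (Suc k) * y) (real (Suc n))) sums (A + pi / (2 * y))"
    using lattice_kernel_iterated_sums[OF y] by blast
  have lattice_kernel_inv: "lattice_kernel (real (Suc n) * (1 / y)) (real (Suc k)) = - y\<^sup>2 * lattice_kernel (real (Suc k) * y) (real (Suc n))" for k n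
  proof -
    have "(real (Suc n) * (1 / y))\<^sup>2 = (real (Suc n))\<^sup>2 / y\<^sup>2" by (simp add: power_divide)
    moreover have "(real (Suc n))\<^sup>2 + (real (Suc k) * y)\<^sup>2 > 0" by (intro add_pos_nonneg) auto
    ultimately show ?thesis
      using y by (simp add: lattice_kernel_def power_mult_distrib field_simps del: of_nat_Suc)
  qed
  have "(\<lambda>n. - y\<^sup>2 * (\<Sum>k. lattice_kernel (real (Suc k) * y) (real (Suc n)))) sums (- y\<^sup>2 * (A + pi / (2 * y)))"
    by (intro sums_mult A)
  also have "(\<lambda>n. - y\<^sup>2 * (\<Sum>k. lattice_kernel (real (Suc k) * y) (real (Suc n)))) =
      (\<lambda>n. (\<Sum>k. lattice_kernel (real (Suc n) * (1 / y)) (real (Suc k))))"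
    using suminf_mult[OF summable_lattice_kernel(2)[OF y], of "- y\<^sup>2"] by (simp only: lattice_kernel_inv)
  finally have "csch_sum (1 / y) = 2 * (- y\<^sup>2 * (A + pi / (2 * y))) + pi\<^sup>2 / 6 / (1 / y)\<^sup>2"
    using csch_sum_sums[of "1 / y"] y by (simp add: csch_sum_def sums_iff)
  hence "csch_sum (1 / y) = - 2 * y\<^sup>2 * A - pi * y + pi\<^sup>2 / 6 * y\<^sup>2"
    using y by (simp add: power_divide distrib_left power2_eq_square)
  moreover have "csch_sum y = 2 * A + pi\<^sup>2 / 6 / y\<^sup>2"
    using csch_sum_sums[OF y A(1)] by (simp add: csch_sum_def sums_iff)
  hence "y\<^sup>2 * csch_sum y = 2 * y\<^sup>2 * A + pi\<^sup>2 / 6"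
    using y by (simp add: field_simps)
  ultimately show ?thesis by (simp add: algebra_simps)
qed

section \<open>Inversion of the Dedekind eta function\<close>

definition euler_prod :: "complex \<Rightarrow> complex" where
  "euler_prod q = (\<Prod>n. 1 - q ^ Suc n)"

definition nome :: "complex \<Rightarrow> complex" where
  "nome z = exp (2 * of_real pi * \<i> * z)"

lemma norm_nome: "norm (nome z) = exp (- 2 * pi * Im z)"
  by (simp add: nome_def)

lemma norm_nome_less_1: "Im z > 0 \<Longrightarrow> norm (nome z) < 1"
  by (simp add: norm_nome)

lemma dedekind_eta_altdef:
  "dedekind_eta z = exp (2 * of_real pi * \<i> * z / 24) * euler_prod (nome z)"
  by (simp add: dedekind_eta_def euler_prod_def nome_def)

lemma convergent_prod_euler:
  fixes q :: complex
  assumes "norm q < 1"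
  shows "convergent_prod (\<lambda>n. 1 - q ^ Suc n)"
proof (rule abs_convergent_prod_imp_convergent_prod, rule summable_imp_abs_convergent_prod)
  have "summable (\<lambda>n. norm q ^ Suc n)"
    using assms by (subst summable_Suc_iff) (rule summable_geometric, simp)
  thus "summable (\<lambda>n. norm (1 - q ^ Suc n - 1))" by (simp add: norm_mult norm_power)
qed

lemma one_minus_power_nonzero:
  fixes q :: complex
  assumes "norm q < 1"
  shows "1 - q ^ Suc n \<noteq> 0"
proof
  assume "1 - q ^ Suc n = 0"
  hence "norm q ^ Suc n = 1" by (metis norm_one norm_power right_minus_eq)
  thus False using assms power_Suc_less_one[of "norm q" n] by (cases "q = 0") auto
qed

lemma euler_prod_nonzero: "norm q < 1 \<Longrightarrow> euler_prod q \<noteq> 0"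
  unfolding euler_prod_def by (intro prodinf_nonzero convergent_prod_euler one_minus_power_nonzero)

text \<open>Both the holomorphy of the product and its termwise logarithmic differentiation rest on
  uniform convergence on closed discs of radius below 1.\<close>

lemma uniform_limit_euler_prod:
  assumes r: "0 \<le> r" "r < 1"
  shows "uniform_limit (cball 0 r) (\<lambda>N q. \<Prod>n<N. 1 - q ^ Suc n) euler_prod sequentially"
proof -
  have "uniformly_convergent_on (cball (0::complex) r) (\<lambda>N q. \<Sum>n<N. norm (1 - q ^ Suc n - 1))"
  proof (rule Weierstrass_m_test')
    show "summable (\<lambda>n. r ^ Suc n)"
      using r by (subst summable_Suc_iff) (rule summable_geometric, simp)
    show "norm (norm (1 - q ^ Suc n - 1)) \<le> r ^ Suc n" if "q \<in> cball 0 r" for n and q :: complex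
    proof -
      have "norm (1 - q ^ Suc n - 1) = norm q ^ Suc n" by (simp add: norm_mult norm_power)
      also have "\<dots> \<le> r ^ Suc n" using that by (intro power_mono) auto
      finally show ?thesis by simp
    qed
  qed
  hence "uniformly_convergent_on (cball (0::complex) r) (\<lambda>N q. \<Prod>n<N. 1 - q ^ Suc n)"
    by (intro uniformly_convergent_on_prod' continuous_intros compact_cball)
  then obtain l where l: "uniform_limit (cball 0 r) (\<lambda>N q :: complex. \<Prod>n<N. 1 - q ^ Suc n) l sequentially"
    by (auto simp: uniformly_convergent_on_def)
  have "l q = euler_prod q" if "q \<in> cball 0 r" for q
  proof -
    have "norm q < 1" using that r by auto
    hence "(\<lambda>n. \<Prod>i\<le>n. 1 - q ^ Suc i) \<longlonglongrightarrow> euler_prod q"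
      unfolding euler_prod_def by (intro convergent_prod_LIMSEQ convergent_prod_euler)
    hence "(\<lambda>n. \<Prod>i<n. 1 - q ^ Suc i) \<longlonglongrightarrow> euler_prod q"
      by (subst (asm) LIMSEQ_lessThan_iff_atMost [symmetric])
    with tendsto_uniform_limitI[OF l that] show ?thesis by (rule LIMSEQ_unique)
  qed
  thus ?thesis by (intro uniform_limit_cong'[THEN iffD1, OF _ _ l]) auto
qed

lemma norm_less_1_cball:
  fixes q :: complex
  assumes "norm q < 1"
  obtains r where "0 \<le> r" "r < 1" "q \<in> ball 0 r"
  using dense[OF assms] norm_ge_zero[of q] by (metis dual_order.trans dual_order.strict_implies_order mem_ball_0)

lemma holomorphic_euler_prod: "euler_prod holomorphic_on ball 0 1"
proof (rule holomorphic_uniform_sequence)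
  fix q :: complex assume "q \<in> ball 0 1"
  then obtain r where r: "0 \<le> r" "r < 1" "q \<in> ball 0 r" using norm_less_1_cball[of q] by auto
  then obtain d where d: "d > 0" "cball q d \<subseteq> ball 0 r"
    by (meson open_ball open_contains_cball)
  have "uniform_limit (cball q d) (\<lambda>N q. \<Prod>n<N. 1 - q ^ Suc n) euler_prod sequentially"
    by (rule uniform_limit_on_subset[OF uniform_limit_euler_prod[OF r(1,2)]]) (use d in auto)
  moreover have "cball q d \<subseteq> ball 0 1" using d r by (meson order_trans subset_ball less_imp_le)
  ultimately show "\<exists>d>0. cball q d \<subseteq> ball 0 1 \<and> uniform_limit (cball q d) (\<lambda>N q. \<Prod>n<N. 1 - q ^ Suc n) euler_prod sequentially"
    using d by blast
qed (auto intro!: holomorphic_intros)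

lemma logderiv_euler_prod_sums:
  assumes q: "norm q < 1"
  shows "(\<lambda>n. - (of_nat (Suc n) * q ^ n / (1 - q ^ Suc n))) sums (deriv euler_prod q / euler_prod q)"
proof -
  obtain r where r: "0 \<le> r" "r < 1" "q \<in> ball 0 r" using norm_less_1_cball[OF q] .
  have "(\<lambda>n. deriv (\<lambda>q. 1 - q ^ Suc n) q / (1 - q ^ Suc n)) sums (deriv euler_prod q / euler_prod q)"
    by (rule logderiv_prodinf_complex_uniform_limit[OF uniform_limit_on_subset[OF uniform_limit_euler_prod[OF r(1,2)]], of "ball 0 r"])
       (use r q in \<open>auto intro!: holomorphic_intros euler_prod_nonzero\<close>)
  moreover have "deriv (\<lambda>q :: complex. 1 - q ^ Suc n) q = - (of_nat (Suc n) * q ^ n)" for n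
    by (rule DERIV_imp_deriv) (auto intro!: derivative_eq_intros simp del: power_Suc)
  ultimately show ?thesis by (simp del: of_nat_Suc power_Suc)
qed

lemma Suc_mult_power_sums:
  fixes x :: real
  assumes "\<bar>x\<bar> < 1"
  shows "(\<lambda>n. real (Suc n) * x ^ Suc n) sums (x / (1 - x)\<^sup>2)"
  using sums_mult[OF geometric_deriv_sums[of x], of x] assms by (simp add: mult_ac)

text \<open>Both sides are the double series of n x^(n k), summed by rows and by columns. The bound
  (n+1)(k+1) >= (n+1) + k on the exponent separates the variables.\<close>

lemma lambert_series_eq:
  fixes x :: real
  assumes x: "0 < x" "x < 1"
  shows "(\<Sum>n. real (Suc n) * x ^ Suc n / (1 - x ^ Suc n)) = (\<Sum>k. x ^ Suc k / (1 - x ^ Suc k)\<^sup>2)"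
proof -
  define f where "f n k = real (Suc n) * x ^ (Suc n * Suc k)" for n k
  have xp: "0 < x ^ Suc k" "x ^ Suc k < 1" for k
    using x by (auto simp: power_Suc_less_one simp del: power_Suc)
  have bound: "\<bar>f n k\<bar> \<le> (real (Suc n) * x ^ Suc n) * x ^ k" for n k
  proof -
    have "x ^ (Suc n * Suc k) \<le> x ^ (Suc n + k)" using x by (intro power_decreasing) auto
    also have "\<dots> = x ^ Suc n * x ^ k" by (rule power_add)
    finally have "real (Suc n) * x ^ (Suc n * Suc k) \<le> real (Suc n) * (x ^ Suc n * x ^ k)"
      by (rule mult_left_mono) simp
    moreover have "f n k \<ge> 0" using x by (simp add: f_def)
    ultimately show ?thesis by (simp only: f_def mult.assoc abs_of_nonneg)
  qed
  obtain s where s: "(\<lambda>n. \<Sum>k. f n k) sums s" "(\<lambda>k. \<Sum>n. f n k) sums s"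
    using sums_swap_dominated[of f "\<lambda>n. real (Suc n) * x ^ Suc n" "\<lambda>k. x ^ k", OF bound]
      sums_summable[OF Suc_mult_power_sums[of x]] summable_geometric[of x] x by auto
  have "(\<Sum>k. f n k) = real (Suc n) * x ^ Suc n / (1 - x ^ Suc n)" for n
  proof -
    have "(\<lambda>k. real (Suc n) * x ^ Suc n * (x ^ Suc n) ^ k) sums (real (Suc n) * x ^ Suc n * (1 / (1 - x ^ Suc n)))"
      using xp[of n] by (intro sums_mult geometric_sums) auto
    also have "(\<lambda>k. real (Suc n) * x ^ Suc n * (x ^ Suc n) ^ k) = f n"
      unfolding f_def fun_eq_iff by (simp only: power_mult power_Suc mult.assoc simp_thms)
    finally show ?thesis by (simp add: sums_iff)
  qed
  moreover have "(\<Sum>n. f n k) = x ^ Suc k / (1 - x ^ Suc k)\<^sup>2" for k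
  proof -
    have "(\<lambda>n. real (Suc n) * (x ^ Suc k) ^ Suc n) sums (x ^ Suc k / (1 - x ^ Suc k)\<^sup>2)"
      using xp[of k] by (intro Suc_mult_power_sums) auto
    also have "(\<lambda>n. real (Suc n) * (x ^ Suc k) ^ Suc n) = (\<lambda>n. f n k)"
      unfolding f_def power_mult [symmetric] by (simp only: mult.commute[of "Suc k"])
    finally show ?thesis by (simp add: sums_iff)
  qed
  ultimately show ?thesis using s by (simp add: sums_iff)
qed

section \<open>The logarithmic derivative of eta and the modulus of its inversion formula\<close>

text \<open>This is (pi i / 12) E_2, written through the Euler product.\<close>

definition eta_logderiv :: "complex \<Rightarrow> complex" where
  "eta_logderiv z = 2 * of_real pi * \<i> * (1 / 24 + nome z * (deriv euler_prod (nome z) / euler_prod (nome z)))"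

text \<open>On the imaginary axis the nome is the real number x = exp (-2 pi y). After the Lambert
  series has been regrouped, each term x^k / (1 - x^k)^2 equals 1 / (4 sinh (pi k y)^2).\<close>

lemma eta_logderiv_imaginary:
  assumes y: "y > 0"
  shows "eta_logderiv (\<i> * of_real y) = 2 * of_real pi * \<i> * of_real (1 / 24 - csch_sum y / (4 * pi\<^sup>2))"
proof -
  define x where "x = exp (- 2 * pi * y)"
  have x: "0 < x" "x < 1" using y by (auto simp: x_def)
  have nome: "nome (\<i> * of_real y) = of_real x"
  proof -
    have "2 * of_real pi * \<i> * (\<i> * of_real y) = complex_of_real (- 2 * pi * y)"
      by (simp add: complex_eq_iff)
    thus ?thesis by (simp only: nome_def x_def exp_of_real)
  qed
  have "(\<lambda>n. of_real x * - (of_nat (Suc n) * of_real x ^ n / (1 - of_real x ^ Suc n))) sums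
      (of_real x * (deriv euler_prod (of_real x) / euler_prod (of_real x)))"
    using x by (intro sums_mult logderiv_euler_prod_sums) auto
  also have "(\<lambda>n. of_real x * - (of_nat (Suc n) * of_real x ^ n / (1 - of_real x ^ Suc n))) =
     (\<lambda>n. complex_of_real (- (real (Suc n) * x ^ Suc n / (1 - x ^ Suc n))))"
    by (simp add: fun_eq_iff)
  finally have *: "(\<lambda>n. complex_of_real (- (real (Suc n) * x ^ Suc n / (1 - x ^ Suc n)))) sums
      (of_real x * (deriv euler_prod (of_real x) / euler_prod (of_real x)))" .
  have "summable (\<lambda>n. - (real (Suc n) * x ^ Suc n / (1 - x ^ Suc n)))"
    using sums_summable[OF *] by (simp only: summable_of_real_iff)
  hence sm: "summable (\<lambda>n. real (Suc n) * x ^ Suc n / (1 - x ^ Suc n))"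
    by (simp only: summable_minus_iff)
  have "of_real x * (deriv euler_prod (of_real x) / euler_prod (of_real x)) =
       complex_of_real (- (\<Sum>n. real (Suc n) * x ^ Suc n / (1 - x ^ Suc n)))"
    using sums_unique2[OF * sums_of_real[OF sums_minus[OF summable_sums[OF sm]]]] by simp
  also have "(\<Sum>n. real (Suc n) * x ^ Suc n / (1 - x ^ Suc n)) = (\<Sum>k. x ^ Suc k / (1 - x ^ Suc k)\<^sup>2)"
    by (rule lambert_series_eq[OF x])
  also have "(\<lambda>k. x ^ Suc k / (1 - x ^ Suc k)\<^sup>2) = (\<lambda>k. pi\<^sup>2 / (sinh (pi * (real (Suc k) * y)))\<^sup>2 / (4 * pi\<^sup>2))"
  proof
    fix k
    define u where "u = exp (pi * (real (Suc k) * y))"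
    have u: "u > 0" by (simp add: u_def)
    have "x ^ Suc k = exp (real (Suc k) * (- 2 * pi * y))" unfolding x_def by (rule exp_of_nat_mult [symmetric])
    also have "\<dots> = exp (- (pi * (real (Suc k) * y) + pi * (real (Suc k) * y)))" by (simp add: algebra_simps)
    also have "\<dots> = inverse u * inverse u" by (simp only: u_def exp_minus exp_add inverse_mult_distrib)
    finally have xk: "x ^ Suc k = inverse u * inverse u" .
    define v where "v = inverse u"
    have v: "v > 0" using u by (simp add: v_def)
    have sh: "sinh (pi * (real (Suc k) * y)) = (1 - v * v) / (2 * v)"
    proof -
      have "sinh (pi * (real (Suc k) * y)) = (u - v) / 2"
        by (simp add: sinh_def u_def v_def exp_minus)
      also have "\<dots> = (1 - v * v) / (2 * v)" using u by (simp add: v_def field_simps)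
      finally show ?thesis .
    qed
    show "x ^ Suc k / (1 - x ^ Suc k)\<^sup>2 = pi\<^sup>2 / (sinh (pi * (real (Suc k) * y)))\<^sup>2 / (4 * pi\<^sup>2)"
    proof -
      have "v * v / d\<^sup>2 = pi\<^sup>2 / (d / (2 * v))\<^sup>2 / (4 * pi\<^sup>2)" for d
        using v by (simp add: power_divide power_mult_distrib power2_eq_square)
      thus ?thesis unfolding xk sh v_def [symmetric] .
    qed
  qed
  also have "(\<Sum>k. pi\<^sup>2 / (sinh (pi * (real (Suc k) * y)))\<^sup>2 / (4 * pi\<^sup>2)) = csch_sum y / (4 * pi\<^sup>2)"
    unfolding csch_sum_def by (rule suminf_divide[OF csch_sum_summable[OF y]])
  finally show ?thesis by (simp add: eta_logderiv_def nome)
qed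

lemma has_field_derivative_dedekind_eta:
  assumes z: "Im z > 0"
  shows "(dedekind_eta has_field_derivative dedekind_eta z * eta_logderiv z) (at z)"
proof -
  have "(euler_prod has_field_derivative deriv euler_prod (nome z)) (at (nome z))"
    using norm_nome_less_1[OF z] by (intro holomorphic_derivI[OF holomorphic_euler_prod]) auto
  moreover have "(nome has_field_derivative 2 * of_real pi * \<i> * nome z) (at z)"
    unfolding nome_def by (auto intro!: derivative_eq_intros)
  ultimately have "((\<lambda>z. euler_prod (nome z)) has_field_derivative deriv euler_prod (nome z) * (2 * of_real pi * \<i> * nome z)) (at z)"
    by (rule DERIV_chain2)
  hence "(dedekind_eta has_field_derivative
      exp (2 * of_real pi * \<i> * z / 24) * (2 * of_real pi * \<i> / 24) * euler_prod (nome z) +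
      deriv euler_prod (nome z) * (2 * of_real pi * \<i> * nome z) * exp (2 * of_real pi * \<i> * z / 24)) (at z)"
    unfolding dedekind_eta_altdef[abs_def] by (intro DERIV_mult) (auto intro!: derivative_eq_intros simp: mult_ac)
  also have "exp (2 * of_real pi * \<i> * z / 24) * (2 * of_real pi * \<i> / 24) * euler_prod (nome z) +
      deriv euler_prod (nome z) * (2 * of_real pi * \<i> * nome z) * exp (2 * of_real pi * \<i> * z / 24) =
      dedekind_eta z * eta_logderiv z"
    using euler_prod_nonzero[OF norm_nome_less_1[OF z]]
    by (simp add: dedekind_eta_altdef eta_logderiv_def field_simps)
  finally show ?thesis .
qed

lemma dedekind_eta_nonzero: "Im z > 0 \<Longrightarrow> dedekind_eta z \<noteq> 0"
  by (simp add: dedekind_eta_altdef euler_prod_nonzero norm_nome_less_1)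

lemma Im_minus_inverse: "Im (- 1 / z) = Im z / (norm z)\<^sup>2"
  by (simp add: Im_divide cmod_power2)

text \<open>
  The quotient of the two sides is holomorphic, and by the transformation of \<open>csch_sum\<close> its
  derivative vanishes on the imaginary axis, hence identically.
\<close>

lemma norm_dedekind_eta_inversion:
  assumes z: "Im z > 0"
  shows "(norm (dedekind_eta (- 1 / z)))\<^sup>2 = norm z * (norm (dedekind_eta z))\<^sup>2"
proof -
  define H where "H = {z. Im z > 0}"
  have opH: "open H" unfolding H_def by (rule open_halfspace_Im_gt)
  have cvH: "convex H" unfolding H_def by (rule convex_halfspace_Im_gt)
  have H: "w \<noteq> 0" "Im (- 1 / w) > 0" "Im w > 0" if "w \<in> H" for w
  proof -
    show w: "Im w > 0" using that by (simp add: H_def)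
    show "w \<noteq> 0" using w by auto
    thus "Im (- 1 / w) > 0" unfolding Im_minus_inverse using w by (intro divide_pos_pos) auto
  qed
  \<comment> \<open>Squares of eta replace the square root of z by z itself, so that no branch has
    to be chosen.\<close>
  define G where "G z = (dedekind_eta (- 1 / z))\<^sup>2 / (z * (dedekind_eta z)\<^sup>2)" for z
  define G' where "G' z = G z * (2 * eta_logderiv (- 1 / z) / z\<^sup>2 - 1 / z - 2 * eta_logderiv z)" for z
  have deriv: "(G has_field_derivative G' w) (at w)" if w: "w \<in> H" for w
  proof -
    note [derivative_intros] = DERIV_chain2[OF has_field_derivative_dedekind_eta]
    show ?thesis unfolding G_def G'_def using H[OF w] dedekind_eta_nonzero[OF H(3)[OF w]]
      by (auto intro!: derivative_eq_intros simp del: divide_minus_left)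
         (simp add: field_simps power2_eq_square)
  qed
  have "G holomorphic_on H"
    using deriv by (auto simp: holomorphic_on_def field_differentiable_def intro: has_field_derivative_at_within)
  hence holo: "deriv G holomorphic_on H" by (rule holomorphic_deriv[OF _ opH])
  have axis: "deriv G w = 0" if "w \<in> (\<lambda>y. \<i> * of_real y) ` {0<..}" for w
  proof -
    from that obtain y where y: "y > 0" "w = \<i> * of_real y" by auto
    have w: "w \<in> H" using y by (simp add: H_def)
    have inv: "- 1 / w = \<i> * of_real (1 / y)" using y by (simp add: field_simps)
    have inv2: "1 / w = - \<i> * of_real (1 / y)" using y by (simp add: field_simps)
    have sq: "w\<^sup>2 = - of_real (y\<^sup>2)" using y by (simp add: power_mult_distrib)
    have csch: "csch_sum (1 / y) = pi\<^sup>2 / 6 * (1 + y\<^sup>2) - pi * y - y\<^sup>2 * csch_sum y"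
      using csch_sum_inversion[OF y(1)] by simp
    have "2 * eta_logderiv (- 1 / w) / w\<^sup>2 - 1 / w - 2 * eta_logderiv w =
       \<i> * of_real (- (4 * pi * (1 / 24 - csch_sum (1 / y) / (4 * pi\<^sup>2))) / y\<^sup>2 + 1 / y
         - 4 * pi * (1 / 24 - csch_sum y / (4 * pi\<^sup>2)))"
      using eta_logderiv_imaginary[OF y(1), folded y(2)] eta_logderiv_imaginary[of "1 / y"] y(1) inv2
      unfolding inv sq by (simp add: complex_eq_iff)
    also have "- (4 * pi * (1 / 24 - csch_sum (1 / y) / (4 * pi\<^sup>2))) / y\<^sup>2 + 1 / y
         - 4 * pi * (1 / 24 - csch_sum y / (4 * pi\<^sup>2)) = 0"
      unfolding csch using y by (simp add: field_simps power2_eq_square)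
    finally have "G' w = 0" by (simp add: G'_def)
    thus ?thesis using deriv[OF w] by (simp add: DERIV_imp_deriv)
  qed
  have limpt: "\<i> islimpt ((\<lambda>y. \<i> * of_real y) ` {0<..})"
    unfolding islimpt_approachable
  proof safe
    fix e :: real assume e: "e > 0"
    have "dist (\<i> * of_real (1 + e / 2)) \<i> = norm (\<i> * of_real (e / 2))"
      by (simp add: dist_norm algebra_simps)
    also have "\<dots> < e" using e by (simp add: norm_mult)
    finally show "\<exists>x'\<in>(\<lambda>y. \<i> * of_real y) ` {0<..}. x' \<noteq> \<i> \<and> dist x' \<i> < e"
      using e by (intro bexI[of _ "\<i> * of_real (1 + e / 2)"]) (auto simp: complex_eq_iff)
  qed
  have "deriv G w = 0" if "w \<in> H" for w
    by (rule analytic_continuation[OF holo opH convex_connected[OF cvH] _ _ limpt axis that])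
       (auto simp: H_def)
  hence "(G has_field_derivative 0) (at w within H)" if "w \<in> H" for w
    using deriv[OF that] that by (metis DERIV_imp_deriv has_field_derivative_at_within)
  then obtain c where c: "G w = c" if "w \<in> H" for w
    using has_field_derivative_zero_constant[OF cvH] by blast
  have zH: "z \<in> H" "\<i> \<in> H" using z by (auto simp: H_def)
  \<comment> \<open>The fixed point of z -> -1/z determines the constant: the eta values cancel, and
    what remains has modulus 1.\<close>
  have "G \<i> = 1 / \<i>"
    using dedekind_eta_nonzero[of \<i>] by (simp add: G_def)
  hence "norm (G z) = 1" using c[OF zH(1)] c[OF zH(2)] by (simp add: norm_divide)
  thus ?thesis using H(1)[OF zH(1)] dedekind_eta_nonzero[OF z]
    by (simp add: G_def norm_divide norm_mult norm_power field_simps)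
qed

section \<open>Orders of eta quotients at the cusps\<close>

lemma norm_dedekind_eta:
  "norm (dedekind_eta z) = exp (- (pi / 12) * Im z) * norm (euler_prod (nome z))"
  by (simp add: dedekind_eta_altdef norm_mult)

lemma nome_add_int: "nome (z + of_int n) = nome z"
proof -
  have "exp (2 * of_real pi * \<i> * of_int n) = 1"
    using exp_integer_2pi[of "of_int n"] by (simp add: mult_ac)
  thus ?thesis by (simp add: nome_def ring_distribs exp_add)
qed

text \<open>The fourth power of the modulus picks up |c z + d|^2 under a modular transformation,
  exactly what Im z loses.\<close>

definition invariant_eta :: "complex \<Rightarrow> real" where
  "invariant_eta z = norm (dedekind_eta z) ^ 4 * Im z"

lemma invariant_eta_add_int: "invariant_eta (z + of_int n) = invariant_eta z"
  by (simp add: invariant_eta_def norm_dedekind_eta nome_add_int)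

lemma invariant_eta_inversion:
  assumes "Im z > 0"
  shows "invariant_eta (- 1 / z) = invariant_eta z"
proof -
  have nz: "norm z \<noteq> 0" using assms by auto
  have four: "x ^ 4 = (x\<^sup>2)\<^sup>2" for x :: real by simp
  show ?thesis
    unfolding invariant_eta_def Im_minus_inverse four norm_dedekind_eta_inversion[OF assms]
    using nz by (simp add: power_mult_distrib)
qed

lemma Im_moebius:
  fixes a b c d :: int
  shows "Im ((of_int a * z + of_int b) / (of_int c * z + of_int d)) =
    of_int (a * d - b * c) * Im z / (norm (of_int c * z + of_int d))\<^sup>2"
proof -
  have "Im (of_int a * z + of_int b) * Re (of_int c * z + of_int d) -
      Re (of_int a * z + of_int b) * Im (of_int c * z + of_int d) = of_int (a * d - b * c) * Im z"
    by (simp add: algebra_simps)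
  thus ?thesis by (simp only: Im_divide cmod_power2)
qed

lemma moebius_denominator_nonzero:
  fixes a b c d :: int
  assumes "Im z > 0" "a * d - b * c \<noteq> 0"
  shows "of_int c * z + of_int d \<noteq> 0"
proof
  assume *: "of_int c * z + of_int d = 0"
  from arg_cong[OF this, of Im] assms(1) have "c = 0" by simp
  with * assms(2) show False by simp
qed

text \<open>The Euclidean algorithm on the first column brings the matrix to upper triangular form.\<close>

lemma invariant_eta_upper_triangular:
  fixes a b c d m :: int
  assumes "a * d - b * c = m" "m > 0"
  shows "\<exists>\<beta> \<delta>. gcd a c * \<delta> = m \<and> (\<forall>z. Im z > 0 \<longrightarrow>
    invariant_eta ((of_int a * z + of_int b) / (of_int c * z + of_int d)) =
    invariant_eta ((of_int (gcd a c) * z + of_int \<beta>) / of_int \<delta>))"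
  using assms
proof (induction "nat \<bar>c\<bar>" arbitrary: a b c d rule: less_induct)
  case less
  show ?case
  proof (cases "c = 0")
    case True
    hence ad: "a * d > 0" "a * d = m" using less.prems by auto
    show ?thesis
    proof (cases "a > 0")
      case a: True
      thus ?thesis using True ad by (intro exI[of _ b] exI[of _ d]) auto
    next
      case False
      \<comment> \<open>Negating the whole matrix leaves the transformation unchanged and makes the
        upper left entry the positive gcd.\<close>
      hence "a < 0" "d < 0" using ad(1) by (auto simp: zero_less_mult_iff)
      moreover have "(of_int a * z + of_int b) / of_int d = (of_int (- a) * z + of_int (- b)) / of_int (- d)" for z :: complex
        using \<open>d < 0\<close> by (simp add: field_simps)
      ultimately show ?thesis using True ad by (intro exI[of _ "- b"] exI[of _ "- d"]) auto
    qed
  next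
    case False
    \<comment> \<open>Translation by -q followed by z -> -1/z changes the rows to (-c, -d) and (a -
      q c, b - q d). The determinant is preserved and the lower left entry becomes a mod c.\<close>
    define q where "q = a div c"
    define r where "r = a mod c"
    have r: "r = a - q * c" by (simp add: r_def q_def minus_div_mult_eq_mod)
    have "nat \<bar>r\<bar> < nat \<bar>c\<bar>" using False by (simp add: r_def abs_mod_less)
    moreover have "(- c) * (b - q * d) - (- d) * r = m" using less.prems(1) by (simp add: r algebra_simps)
    ultimately obtain \<beta> \<delta> where IH: "gcd (- c) r * \<delta> = m" "\<And>z. Im z > 0 \<Longrightarrow>
      invariant_eta ((of_int (- c) * z + of_int (- d)) / (of_int r * z + of_int (b - q * d))) =
      invariant_eta ((of_int (gcd (- c) r) * z + of_int \<beta>) / of_int \<delta>)"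
      using less.hyps[of r "- c" "b - q * d" "- d"] less.prems(2) by blast
    have g: "gcd (- c) r = gcd a c" using gcd_red_int[of a c] by (simp add: r_def)
    have "invariant_eta ((of_int a * z + of_int b) / (of_int c * z + of_int d)) =
      invariant_eta ((of_int (- c) * z + of_int (- d)) / (of_int r * z + of_int (b - q * d)))" if z: "Im z > 0" for z
    proof -
      define w where "w = (of_int a * z + of_int b) / (of_int c * z + of_int d)"
      have den: "of_int c * z + of_int d \<noteq> 0"
        using z less.prems by (intro moebius_denominator_nonzero[of z a d b c]) auto
      have "Im w > 0" unfolding w_def Im_moebius using z den less.prems by simp
      hence Im: "Im (w + of_int (- q)) > 0" by simp
      have "invariant_eta w = invariant_eta (w + of_int (- q))" by (rule invariant_eta_add_int [symmetric])
      also have "\<dots> = invariant_eta (- 1 / (w + of_int (- q)))" by (rule invariant_eta_inversion[OF Im, symmetric])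
      also have "w + of_int (- q) = (of_int r * z + of_int (b - q * d)) / (of_int c * z + of_int d)"
        using den by (simp add: w_def r field_simps)
      also have "- 1 / \<dots> = (of_int (- c) * z + of_int (- d)) / (of_int r * z + of_int (b - q * d))"
        by (simp add: minus_divide_left)
      finally show ?thesis by (simp add: w_def)
    qed
    with IH g show ?thesis by auto
  qed
qed

section \<open>Growth of eta quotients at the cusps\<close>

text \<open>Two-sided bounds, with positivity of the comparison function built in, are stable under
  inverses and hence under the negative exponents of an eta quotient; upper bounds alone would not
  be.\<close>

definition comparable_on :: "'a set \<Rightarrow> ('a \<Rightarrow> real) \<Rightarrow> ('a \<Rightarrow> real) \<Rightarrow> bool" where
  "comparable_on S f g \<longleftrightarrow> (\<exists>A>0. \<exists>B>0. \<forall>z\<in>S. 0 < g z \<and> A * g z \<le> f z \<and> f z \<le> B * g z)"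

lemma comparable_onI:
  assumes "A > 0" "B > 0" "\<And>z. z \<in> S \<Longrightarrow> 0 < g z" "\<And>z. z \<in> S \<Longrightarrow> A * g z \<le> f z" "\<And>z. z \<in> S \<Longrightarrow> f z \<le> B * g z"
  shows "comparable_on S f g"
  using assms unfolding comparable_on_def by blast

lemma comparable_on_mult:
  assumes "comparable_on S f g" "comparable_on S f' g'"
  shows "comparable_on S (\<lambda>z. f z * f' z) (\<lambda>z. g z * g' z)"
proof -
  obtain A B where AB: "A > 0" "B > 0" "\<And>z. z \<in> S \<Longrightarrow> 0 < g z" "\<And>z. z \<in> S \<Longrightarrow> A * g z \<le> f z" "\<And>z. z \<in> S \<Longrightarrow> f z \<le> B * g z"
    using assms(1) by (auto simp: comparable_on_def)
  obtain A' B' where AB': "A' > 0" "B' > 0" "\<And>z. z \<in> S \<Longrightarrow> 0 < g' z" "\<And>z. z \<in> S \<Longrightarrow> A' * g' z \<le> f' z" "\<And>z. z \<in> S \<Longrightarrow> f' z \<le> B' * g' z"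
    using assms(2) by (auto simp: comparable_on_def)
  show ?thesis
  proof (rule comparable_onI[of "A * A'" "B * B'"])
    fix z assume z: "z \<in> S"
    have pos: "0 < A * g z" "0 < A' * g' z" using AB AB' z by simp_all
    have "(A * g z) * (A' * g' z) \<le> f z * f' z"
      using pos AB(4)[OF z] AB'(4)[OF z] by (intro mult_mono) auto
    thus "A * A' * (g z * g' z) \<le> f z * f' z" by (simp add: mult_ac)
    have "f z * f' z \<le> (B * g z) * (B' * g' z)"
      using pos AB(4)[OF z] AB(5)[OF z] AB'(4)[OF z] AB'(5)[OF z] by (intro mult_mono) linarith+
    thus "f z * f' z \<le> B * B' * (g z * g' z)" by (simp add: mult_ac)
  qed (use AB AB' in auto)
qed

lemma comparable_on_inverse:
  assumes "comparable_on S f g"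
  shows "comparable_on S (\<lambda>z. inverse (f z)) (\<lambda>z. inverse (g z))"
proof -
  obtain A B where AB: "A > 0" "B > 0" "\<And>z. z \<in> S \<Longrightarrow> 0 < g z" "\<And>z. z \<in> S \<Longrightarrow> A * g z \<le> f z" "\<And>z. z \<in> S \<Longrightarrow> f z \<le> B * g z"
    using assms by (auto simp: comparable_on_def)
  show ?thesis
  proof (rule comparable_onI[of "inverse B" "inverse A"])
    fix z assume z: "z \<in> S"
    have pos: "0 < A * g z" using AB z by simp
    show "inverse (f z) \<le> inverse A * inverse (g z)"
      using le_imp_inverse_le[OF AB(4)[OF z] pos] by (simp add: mult.commute)
    show "inverse B * inverse (g z) \<le> inverse (f z)"
      using le_imp_inverse_le[OF AB(5)[OF z]] pos AB(4)[OF z] by (simp add: mult.commute)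
  qed (use AB in auto)
qed

lemma comparable_on_refl: "(\<And>z. z \<in> S \<Longrightarrow> 0 < g z) \<Longrightarrow> comparable_on S g g"
  by (rule comparable_onI[of 1 1]) auto

lemma comparable_on_power_int:
  assumes "comparable_on S f g"
  shows "comparable_on S (\<lambda>z. f z powi n) (\<lambda>z. g z powi n)"
proof -
  have pow: "comparable_on S (\<lambda>z. f z ^ k) (\<lambda>z. g z ^ k)" for k
    by (induction k) (auto intro: comparable_on_refl comparable_on_mult assms)
  show ?thesis
  proof (cases "n \<ge> 0")
    case True
    thus ?thesis using pow[of "nat n"] by (simp add: power_int_def)
  next
    case False
    thus ?thesis using comparable_on_inverse[OF pow[of "nat (- n)"]] by (simp add: power_int_def power_inverse)
  qed
qed

lemma comparable_on_prod:
  assumes "\<And>i. i \<in> I \<Longrightarrow> comparable_on S (f i) (g i)"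
  shows "comparable_on S (\<lambda>z. \<Prod>i\<in>I. f i z) (\<lambda>z. \<Prod>i\<in>I. g i z)"
  using assms by (induction I rule: infinite_finite_induct) (auto intro: comparable_on_refl comparable_on_mult)

lemma comparable_on_cong:
  assumes "comparable_on S f g" "\<And>z. z \<in> S \<Longrightarrow> f z = f' z" "\<And>z. z \<in> S \<Longrightarrow> g z = g' z"
  shows "comparable_on S f' g'"
  using assms unfolding comparable_on_def by fastforce

text \<open>The nome maps the half plane Im w >= h into a closed disc of radius below 1. There the
  Euler product is continuous and has no zeros, so compactness bounds its modulus on both
  sides.\<close>

lemma euler_prod_nome_bounds:
  assumes "h > 0"
  obtains A B where "A > 0" "B > 0"
    "\<And>w. Im w \<ge> h \<Longrightarrow> A \<le> norm (euler_prod (nome w))" "\<And>w. Im w \<ge> h \<Longrightarrow> norm (euler_prod (nome w)) \<le> B"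
proof -
  define r where "r = exp (- 2 * pi * h)"
  have r: "0 < r" "r < 1" using assms by (auto simp: r_def)
  have "continuous_on (cball 0 r) euler_prod"
    by (rule holomorphic_on_imp_continuous_on, rule holomorphic_on_subset[OF holomorphic_euler_prod]) (use r in auto)
  hence cont: "continuous_on (cball 0 r) (\<lambda>q. norm (euler_prod q))" by (intro continuous_intros)
  have ne: "cball (0::complex) r \<noteq> {}" using r by simp
  obtain q0 where q0: "q0 \<in> cball 0 r" "\<And>q. q \<in> cball 0 r \<Longrightarrow> norm (euler_prod q0) \<le> norm (euler_prod q)"
    using continuous_attains_inf[OF compact_cball ne cont] by blast
  obtain q1 where q1: "q1 \<in> cball 0 r" "\<And>q. q \<in> cball 0 r \<Longrightarrow> norm (euler_prod q) \<le> norm (euler_prod q1)"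
    using continuous_attains_sup[OF compact_cball ne cont] by blast
  have nome: "nome w \<in> cball 0 r" if "Im w \<ge> h" for w
    using that by (simp add: norm_nome r_def)
  have pos: "norm (euler_prod q0) > 0" "norm (euler_prod q1) > 0"
    using q0(1) q1(1) r euler_prod_nonzero by auto
  show thesis
    by (rule that[OF pos]) (intro q0(2) q1(2) nome, assumption)+
qed

text \<open>Multiplying the top row by m gives a matrix of determinant m whose first column has gcd
  g = gcd m c, since a and c are coprime. Its triangular form has diagonal g, m / g, so the new
  argument has height g^2 / m * Im z; this is the exponential rate. The Euler product stays bounded
  on both sides as long as Im z >= 1, and the invariance of |eta|^4 Im z supplies the square root of
  |c z + d|.\<close>

lemma comparable_dedekind_eta_cusp:
  fixes a b c d :: int and m :: nat
  assumes det: "a * d - b * c = 1" and m: "m > 0"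
  defines "g \<equiv> real (gcd m (nat \<bar>c\<bar>))"
  shows "comparable_on {z. Im z \<ge> 1}
    (\<lambda>z. norm (dedekind_eta (of_nat m * ((of_int a * z + of_int b) / (of_int c * z + of_int d)))))
    (\<lambda>z. exp (- (pi / 12) * (g\<^sup>2 / m) * Im z) * sqrt (norm (of_int c * z + of_int d)))"
proof -
  have gcd: "gcd (int m * a) c = int (gcd m (nat \<bar>c\<bar>))"
  proof -
    have "coprime a c" using det by (intro coprimeI) (metis dvd_diff dvd_mult2 dvd_mult)
    hence "gcd (int m * a) c = gcd (int m) c" by (simp add: gcd_mult_left_right_cancel coprime_commute)
    also have "\<dots> = gcd (int m) (int (nat \<bar>c\<bar>))" by simp
    also have "\<dots> = int (gcd m (nat \<bar>c\<bar>))" by (rule gcd_int_int_eq)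
    finally show ?thesis .
  qed
  have det': "(int m * a) * d - (int m * b) * c = int m"
    using arg_cong[OF det, of "\<lambda>x. int m * x"] by (simp add: algebra_simps)
  obtain \<beta> \<delta> where \<delta>: "int (gcd m (nat \<bar>c\<bar>)) * \<delta> = int m" and
    inv: "\<And>z. Im z > 0 \<Longrightarrow> invariant_eta ((of_int (int m * a) * z + of_int (int m * b)) / (of_int c * z + of_int d)) =
        invariant_eta ((of_int (int (gcd m (nat \<bar>c\<bar>))) * z + of_int \<beta>) / of_int \<delta>)"
    using invariant_eta_upper_triangular[OF det', unfolded gcd] m by auto
  have g: "g > 0" using m by (simp add: g_def)
  have g\<delta>: "g * of_int \<delta> = real m" using arg_cong[OF \<delta>, of real_of_int] by (simp add: g_def)
  have \<delta>pos: "real_of_int \<delta> > 0" using g\<delta> g m by (metis of_nat_0_less_iff zero_less_mult_pos)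
  define w where "w z = (of_nat (gcd m (nat \<bar>c\<bar>)) * z + of_int \<beta>) / of_int \<delta>" for z :: complex
  have Imw: "Im (w z) = g / of_int \<delta> * Im z" for z
    using Im_divide_of_real[of "of_nat (gcd m (nat \<bar>c\<bar>)) * z + of_int \<beta>" "of_int \<delta>"]
    by (simp add: w_def g_def)
  have ratio: "g / of_int \<delta> = g\<^sup>2 / real m"
    using g \<delta>pos unfolding g\<delta> [symmetric] by (simp add: power2_eq_square)
  obtain A B where AB: "A > 0" "B > 0"
    "\<And>w. Im w \<ge> g / of_int \<delta> \<Longrightarrow> A \<le> norm (euler_prod (nome w))"
    "\<And>w. Im w \<ge> g / of_int \<delta> \<Longrightarrow> norm (euler_prod (nome w)) \<le> B"
    using euler_prod_nome_bounds[of "g / of_int \<delta>"] g \<delta>pos by auto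
  have eq: "norm (dedekind_eta (of_nat m * ((of_int a * z + of_int b) / (of_int c * z + of_int d)))) =
      norm (euler_prod (nome (w z))) * sqrt (g / m) *
      (exp (- (pi / 12) * (g\<^sup>2 / m) * Im z) * sqrt (norm (of_int c * z + of_int d)))" if z: "Im z \<ge> 1" for z
  \<comment> \<open>Fourth powers are compared because the invariant quantity contains the fourth
    power of the modulus.\<close>
  proof (rule power_eq_imp_eq_base[of _ 4])
    define D where "D = norm (of_int c * z + of_int d)"
    have D: "D > 0" unfolding D_def using z det moebius_denominator_nonzero[of z a d b c] by auto
    define u where "u = of_nat m * ((of_int a * z + of_int b) / (of_int c * z + of_int d))"
    have u: "u = (of_int (int m * a) * z + of_int (int m * b)) / (of_int c * z + of_int d)"
      by (simp add: u_def distrib_left mult.assoc)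
    have "Im u = real m * Im z / D\<^sup>2" unfolding u Im_moebius det' D_def by simp
    moreover have "invariant_eta u = invariant_eta (w z)"
      unfolding u w_def by (rule inv[unfolded of_int_of_nat_eq]) (use z in simp)
    ultimately have *: "norm (dedekind_eta u) ^ 4 * (m * Im z / D\<^sup>2) = norm (dedekind_eta (w z)) ^ 4 * (g\<^sup>2 / m * Im z)"
      unfolding invariant_eta_def Imw ratio by (simp only:)
    have "norm (dedekind_eta u) ^ 4 = norm (dedekind_eta u) ^ 4 * (m * Im z / D\<^sup>2) * (D\<^sup>2 / (m * Im z))"
      using z D m by simp
    also have "\<dots> = norm (dedekind_eta (w z)) ^ 4 * (g\<^sup>2 / m * Im z) * (D\<^sup>2 / (m * Im z))"
      by (simp only: *)
    also have "\<dots> = norm (dedekind_eta (w z)) ^ 4 * (g / m)\<^sup>2 * D\<^sup>2"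
      using z m by (simp add: power_divide power2_eq_square)
    also have "\<dots> = (norm (dedekind_eta (w z)) * sqrt (g / m) * sqrt D) ^ 4"
    proof -
      have "sqrt t ^ 4 = t\<^sup>2" if "t \<ge> 0" for t
      proof -
        have "sqrt t ^ 4 = ((sqrt t)\<^sup>2)\<^sup>2" by simp
        thus ?thesis using that by (simp only: real_sqrt_pow2)
      qed
      from this[of "g / m"] this[of D] show ?thesis using g D by (simp only: power_mult_distrib) simp
    qed
    also have "norm (dedekind_eta (w z)) = exp (- (pi / 12) * (g\<^sup>2 / m) * Im z) * norm (euler_prod (nome (w z)))"
      unfolding norm_dedekind_eta Imw ratio by (simp add: mult.assoc)
    finally show "norm (dedekind_eta u) ^ 4 = (norm (euler_prod (nome (w z))) * sqrt (g / m) *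
      (exp (- (pi / 12) * (g\<^sup>2 / m) * Im z) * sqrt D)) ^ 4" by (simp only: mult_ac)
  qed (use g in auto)
  show ?thesis
  proof (rule comparable_onI[of "A * sqrt (g / m)" "B * sqrt (g / m)"])
    fix z :: complex assume "z \<in> {z. Im z \<ge> 1}"
    hence z: "Im z \<ge> 1" by simp
    define R where "R = exp (- (pi / 12) * (g\<^sup>2 / m) * Im z) * sqrt (norm (of_int c * z + of_int d))"
    have "of_int c * z + of_int d \<noteq> 0" using z det moebius_denominator_nonzero[of z a d b c] by auto
    hence R: "R > 0" by (simp add: R_def)
    thus "0 < exp (- (pi / 12) * (g\<^sup>2 / m) * Im z) * sqrt (norm (of_int c * z + of_int d))"
      by (simp only: R_def)
    have "g / of_int \<delta> * 1 \<le> g / of_int \<delta> * Im z" using z g \<delta>pos by (intro mult_left_mono) auto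
    hence Im: "Im (w z) \<ge> g / of_int \<delta>" by (simp add: Imw)
    have nonneg: "0 \<le> sqrt (g / m) * R" using R g by simp
    show "A * sqrt (g / m) * (exp (- (pi / 12) * (g\<^sup>2 / m) * Im z) * sqrt (norm (of_int c * z + of_int d)))
      \<le> norm (dedekind_eta (of_nat m * ((of_int a * z + of_int b) / (of_int c * z + of_int d))))"
      using mult_right_mono[OF AB(3)[OF Im] nonneg] by (simp only: eq[OF z] R_def mult.assoc)
    show "norm (dedekind_eta (of_nat m * ((of_int a * z + of_int b) / (of_int c * z + of_int d)))) \<le>
      B * sqrt (g / m) * (exp (- (pi / 12) * (g\<^sup>2 / m) * Im z) * sqrt (norm (of_int c * z + of_int d)))"
      using mult_right_mono[OF AB(4)[OF Im] nonneg] by (simp only: eq[OF z] R_def mult.assoc)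
  qed (use AB g m in auto)
qed

text \<open>The coefficients are real so that linear combinations of parts of an exponent family,
  with real scalars, have orders too. Summation over the support makes the order independent of any
  level.\<close>

definition cusp_order :: "(nat \<Rightarrow> real) \<Rightarrow> nat \<Rightarrow> real" where
  "cusp_order f s = (\<Sum>d | f d \<noteq> 0. f d * ((real (gcd d s))\<^sup>2 / real d))"

abbreviation eta_order :: "(nat \<Rightarrow> int) \<Rightarrow> nat \<Rightarrow> real" where
  "eta_order X \<equiv> cusp_order (\<lambda>d. real_of_int (X d))"

lemma sqrt_power_int:
  assumes "x > 0"
  shows "sqrt x powi n = x powr (of_int n / 2)"
proof -
  have "sqrt x powi n = sqrt x powr of_int n" using assms by (simp add: powr_real_of_int')
  also have "\<dots> = (x powr (1 / 2)) powr of_int n" using assms by (simp only: powr_half_sqrt less_imp_le)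
  also have "\<dots> = x powr (of_int n / 2)" by (simp only: powr_powr) simp
  finally show ?thesis .
qed

lemma comparable_eta_quotient_cusp:
  fixes a b c d :: int
  assumes X: "eta_exponents X" and det: "a * d - b * c = 1"
  shows "comparable_on {z. Im z \<ge> 1}
    (\<lambda>z. norm (eta_quotient X ((of_int a * z + of_int b) / (of_int c * z + of_int d))))
    (\<lambda>z. exp (- (pi / 12) * eta_order X (nat \<bar>c\<bar>) * Im z) * norm (of_int c * z + of_int d) powr eta_weight X)"
proof (rule comparable_on_cong)
  define M where "M = {d. X d \<noteq> 0}"
  have fin: "finite M" and M0: "\<And>m. m \<in> M \<Longrightarrow> m > 0"
    using X by (auto simp: M_def eta_exponents_def intro: Nat.gr0I)
  define E where "E m z = exp (- (pi / 12) * ((real (gcd m (nat \<bar>c\<bar>)))\<^sup>2 / m) * Im z)" for m z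
  show "comparable_on {z. Im z \<ge> 1}
    (\<lambda>z. \<Prod>m\<in>M. norm (dedekind_eta (of_nat m * ((of_int a * z + of_int b) / (of_int c * z + of_int d)))) powi X m)
    (\<lambda>z. \<Prod>m\<in>M. (E m z * sqrt (norm (of_int c * z + of_int d))) powi X m)"
    unfolding E_def
    by (intro comparable_on_prod comparable_on_power_int comparable_dedekind_eta_cusp det M0)
  fix z :: complex assume "z \<in> {z. Im z \<ge> 1}"
  hence z: "Im z > 0" by simp
  show "(\<Prod>m\<in>M. norm (dedekind_eta (of_nat m * ((of_int a * z + of_int b) / (of_int c * z + of_int d)))) powi X m) =
    norm (eta_quotient X ((of_int a * z + of_int b) / (of_int c * z + of_int d)))"
    by (simp add: eta_quotient_def M_def norm_power_int flip: prod_norm)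
  define D where "D = norm (of_int c * z + of_int d)"
  have D: "D > 0" unfolding D_def using z det moebius_denominator_nonzero[of z a d b c] by auto
  have "(\<Prod>m\<in>M. (E m z * sqrt D) powi X m) = (\<Prod>m\<in>M. E m z powi X m) * (\<Prod>m\<in>M. sqrt D powi X m)"
    by (simp add: power_int_mult_distrib prod.distrib)
  also have "(\<Prod>m\<in>M. sqrt D powi X m) = (\<Prod>m\<in>M. D powr (of_int (X m) / 2))"
    using D by (simp add: sqrt_power_int)
  also have "\<dots> = D powr (\<Sum>m\<in>M. of_int (X m) / 2)"
    using D fin by (simp add: powr_sum)
  also have "(\<Sum>m\<in>M. of_int (X m) / 2) = eta_weight X"
    by (simp add: eta_weight_def M_def sum_divide_distrib)
  also have "(\<Prod>m\<in>M. E m z powi X m) = exp (\<Sum>m\<in>M. - (pi / 12) * (of_int (X m) * ((real (gcd m (nat \<bar>c\<bar>)))\<^sup>2 / m)) * Im z)"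
    by (simp add: E_def exp_sum fin exp_power_int mult_ac)
  also have "(\<Sum>m\<in>M. - (pi / 12) * (of_int (X m) * ((real (gcd m (nat \<bar>c\<bar>)))\<^sup>2 / m)) * Im z) =
      - (pi / 12) * eta_order X (nat \<bar>c\<bar>) * Im z"
    unfolding cusp_order_def by (simp only: sum_distrib_left sum_distrib_right M_def of_int_eq_0_iff)
  finally show "(\<Prod>m\<in>M. (E m z * sqrt (norm (of_int c * z + of_int d))) powi X m) =
     exp (- (pi / 12) * eta_order X (nat \<bar>c\<bar>) * Im z) * norm (of_int c * z + of_int d) powr eta_weight X"
    by (simp only: D_def)
qed

text \<open>The square roots of |c z + d| from the single eta factors multiply up to the power
  \<open>eta_weight X\<close>, which the slash operator removes. A pure exponential is left.\<close>

lemma comparable_slash: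
  fixes a b c d :: int
  assumes X: "eta_exponents X" and det: "a * d - b * c = 1"
  shows "comparable_on {z. Im z \<ge> 1} (\<lambda>z. norm (slash (eta_weight X) a b c d (eta_quotient X) z))
    (\<lambda>z. exp (- (pi / 12) * eta_order X (nat \<bar>c\<bar>) * Im z))"
proof -
  define D where "D z = norm (of_int c * z + of_int d)" for z :: complex
  have D: "D z > 0" if "Im z \<ge> 1" for z
    unfolding D_def using that det moebius_denominator_nonzero[of z a d b c] by auto
  have "comparable_on {z. Im z \<ge> 1} (\<lambda>z. D z powr (- eta_weight X)) (\<lambda>z. D z powr (- eta_weight X))"
    using D by (intro comparable_on_refl) (simp add: less_imp_neq[symmetric])
  from comparable_on_mult[OF this comparable_eta_quotient_cusp[OF X det]] show ?thesis
  proof (rule comparable_on_cong)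
    fix z :: complex assume "z \<in> {z. Im z \<ge> 1}"
    hence z: "Im z \<ge> 1" by simp
    show "D z powr - eta_weight X * norm (eta_quotient X ((of_int a * z + of_int b) / (of_int c * z + of_int d))) =
        norm (slash (eta_weight X) a b c d (eta_quotient X) z)"
      by (simp add: slash_def norm_mult D_def norm_powr_real_powr')
    show "D z powr - eta_weight X * (exp (- (pi / 12) * eta_order X (nat \<bar>c\<bar>) * Im z) * norm (of_int c * z + of_int d) powr eta_weight X) =
        exp (- (pi / 12) * eta_order X (nat \<bar>c\<bar>) * Im z)"
      using D[OF z] by (simp add: powr_minus flip: D_def)
  qed
qed

text \<open>The exponential in \<open>comparable_slash\<close> is bounded for large Im z iff its
  order is nonnegative. The matrix with rows (1, 0) and (s, 1) realizes every s; s = 0 is the cusp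
  at infinity, where gcd d 0 = d.\<close>

lemma holomorphic_eta_quotient_iff:
  assumes X: "eta_exponents X"
  shows "holomorphic_eta_quotient X \<longleftrightarrow> (\<forall>s. 0 \<le> eta_order X s)"
proof
  assume "holomorphic_eta_quotient X"
  hence np: "no_poles_at_cusps (eta_weight X) (eta_quotient X)" by (simp add: holomorphic_eta_quotient_def)
  show "\<forall>s. 0 \<le> eta_order X s"
  proof
    fix s :: nat
    have "comparable_on {z. Im z \<ge> 1} (\<lambda>z. norm (slash (eta_weight X) 1 0 (int s) 1 (eta_quotient X) z))
      (\<lambda>z. exp (- (pi / 12) * eta_order X (nat \<bar>int s\<bar>) * Im z))"
      by (rule comparable_slash[OF X]) simp
    then obtain A where A: "A > 0" "\<And>z. Im z \<ge> 1 \<Longrightarrow>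
        A * exp (- (pi / 12) * eta_order X s * Im z) \<le> norm (slash (eta_weight X) 1 0 (int s) 1 (eta_quotient X) z)"
      unfolding comparable_on_def by auto
    have "Bfun (slash (eta_weight X) 1 0 (int s) 1 (eta_quotient X)) (filtercomap Im at_top)"
      using np unfolding no_poles_at_cusps_def by simp
    then obtain K where K: "K > 0"
      "eventually (\<lambda>z. norm (slash (eta_weight X) 1 0 (int s) 1 (eta_quotient X) z) \<le> K) (filtercomap Im at_top)"
      by (rule BfunE)
    then obtain y0 where y0: "\<And>z. Im z \<ge> y0 \<Longrightarrow> norm (slash (eta_weight X) 1 0 (int s) 1 (eta_quotient X) z) \<le> K"
      by (auto simp: eventually_filtercomap_at_top_linorder)
    show "0 \<le> eta_order X s"
    proof (rule ccontr)
      assume neg: "\<not> 0 \<le> eta_order X s"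
      define e where "e = - (pi / 12) * eta_order X s"
      have e: "e > 0" using neg pi_gt_zero unfolding e_def by (simp add: mult_less_0_iff)
      \<comment> \<open>Beyond this height exp (e y) > e y >= K / A, so the lower bound already
        exceeds K.\<close>
      define y where "y = max (max 1 y0) (K / A / e)"
      have y: "1 \<le> y" "y0 \<le> y" by (simp_all add: y_def)
      have "K / A / e \<le> y" by (simp add: y_def)
      hence "K / A \<le> e * y" using e by (subst (asm) pos_divide_le_eq) (simp_all add: mult.commute)
      also have "e * y < exp (e * y)" using exp_ge_add_one_self[of "e * y"] by linarith
      finally have "K < A * exp (e * y)" using A(1) by (simp add: field_simps)
      also have "\<dots> \<le> K" using A(2)[of "\<i> * of_real y"] y0[of "\<i> * of_real y"] y by (simp add: e_def)
      finally show False by simp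
    qed
  qed
next
  assume nonneg: "\<forall>s. 0 \<le> eta_order X s"
  show "holomorphic_eta_quotient X"
    unfolding holomorphic_eta_quotient_def no_poles_at_cusps_def
  proof (intro conjI X allI impI)
    fix a b c d :: int assume "a * d - b * c = 1"
    from comparable_slash[OF X this] obtain B where B: "B > 0" "\<And>z. Im z \<ge> 1 \<Longrightarrow>
      norm (slash (eta_weight X) a b c d (eta_quotient X) z) \<le> B * exp (- (pi / 12) * eta_order X (nat \<bar>c\<bar>) * Im z)"
      unfolding comparable_on_def by auto
    show "Bfun (slash (eta_weight X) a b c d (eta_quotient X)) (filtercomap Im at_top)"
    proof (rule BfunI)
      have "norm (slash (eta_weight X) a b c d (eta_quotient X) z) \<le> B" if "Im z \<ge> 1" for z
      proof -
        have "0 \<le> (pi / 12) * eta_order X (nat \<bar>c\<bar>) * Im z" using nonneg that by (intro mult_nonneg_nonneg) auto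
        hence "B * exp (- (pi / 12) * eta_order X (nat \<bar>c\<bar>) * Im z) \<le> B * 1"
          using B(1) by (intro mult_left_mono) auto
        thus ?thesis using B(2)[OF that] by simp
      qed
      thus "eventually (\<lambda>z. norm (slash (eta_weight X) a b c d (eta_quotient X) z) \<le> B) (filtercomap Im at_top)"
        by (auto simp: eventually_filtercomap_at_top_linorder)
    qed
  qed
qed

section \<open>Orders as growth rates of the function itself\<close>

lemma eta_quotient_nonzero:
  assumes "eta_exponents X" "Im z > 0"
  shows "eta_quotient X z \<noteq> 0"
proof -
  have "d > 0" if "X d \<noteq> 0" for d using assms that by (auto simp: eta_exponents_def intro: Nat.gr0I)
  thus ?thesis using assms dedekind_eta_nonzero by (auto simp: eta_quotient_def eta_exponents_def)
qed

text \<open>The order depends on the values of the function only. On the path through the cusp 1/s,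
  the factor |s z + 1| grows at most linearly, so its logarithm, like those of the comparison
  constants, vanishes after division by y.\<close>

lemma ln_eta_quotient_limit:
  assumes X: "eta_exponents X"
  shows "((\<lambda>y. ln (norm (eta_quotient X (\<i> * of_real y / (of_nat s * (\<i> * of_real y) + 1)))) / y)
    \<longlongrightarrow> - (pi / 12) * eta_order X s) at_top"
proof -
  define f where "f y = norm (eta_quotient X (\<i> * of_real y / (of_nat s * (\<i> * of_real y) + 1)))" for y
  define D where "D y = norm (of_nat s * (\<i> * of_real y) + 1 :: complex)" for y
  define e where "e = - (pi / 12) * eta_order X s"
  have "comparable_on {z. Im z \<ge> 1}
    (\<lambda>z. norm (eta_quotient X ((of_int 1 * z + of_int 0) / (of_int (int s) * z + of_int 1))))
    (\<lambda>z. exp (- (pi / 12) * eta_order X (nat \<bar>int s\<bar>) * Im z) * norm (of_int (int s) * z + of_int 1) powr eta_weight X)"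
    by (rule comparable_eta_quotient_cusp[OF X]) simp
  then obtain A B where AB: "A > 0" "B > 0"
     "\<And>z. Im z \<ge> 1 \<Longrightarrow> A * (exp (- (pi / 12) * eta_order X s * Im z) * norm (of_nat s * z + 1) powr eta_weight X) \<le> norm (eta_quotient X (z / (of_nat s * z + 1)))"
     "\<And>z. Im z \<ge> 1 \<Longrightarrow> norm (eta_quotient X (z / (of_nat s * z + 1))) \<le> B * (exp (- (pi / 12) * eta_order X s * Im z) * norm (of_nat s * z + 1) powr eta_weight X)"
    unfolding comparable_on_def by auto
  have D1: "1 \<le> D y" for y
    using abs_Re_le_cmod[of "of_nat s * (\<i> * of_real y) + 1"] by (simp add: D_def)
  have D2: "D y \<le> (real s + 1) * y" if "y \<ge> 1" for y
  proof -
    have "D y \<le> norm (of_nat s * (\<i> * of_real y) :: complex) + 1" unfolding D_def using norm_triangle_ineq[of _ "1 :: complex"] by simp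
    also have "\<dots> = real s * y + 1" using that by (simp add: norm_mult)
    also have "\<dots> \<le> (real s + 1) * y" using that by (simp add: algebra_simps)
    finally show ?thesis .
  qed
  have lnD: "((\<lambda>y. ln (D y) / y) \<longlongrightarrow> 0) at_top"
  proof (rule tendsto_sandwich)
    show "eventually (\<lambda>y. 0 \<le> ln (D y) / y) at_top"
      using eventually_ge_at_top[of 1] by eventually_elim (use D1 in auto)
    show "eventually (\<lambda>y. ln (D y) / y \<le> ln (real s + 1) / y + ln y / y) at_top"
      using eventually_ge_at_top[of 1]
    proof eventually_elim
      case (elim y)
      have "ln (D y) \<le> ln ((real s + 1) * y)" using D1[of y] D2[OF elim] elim by (subst ln_le_cancel_iff) auto
      also have "\<dots> = ln (real s + 1) + ln y" using elim by (simp add: ln_mult)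
      finally show ?case using elim by (simp add: divide_right_mono flip: add_divide_distrib)
    qed
    have "((\<lambda>y. ln (real s + 1) / y + ln y / y) \<longlongrightarrow> 0 + 0) at_top"
      by (intro tendsto_add tendsto_divide_0[OF tendsto_const] ln_x_over_x_tendsto_0 filterlim_at_top_imp_at_infinity filterlim_ident)
    thus "((\<lambda>y. ln (real s + 1) / y + ln y / y) \<longlongrightarrow> 0) at_top" by simp
  qed simp
  have lim: "((\<lambda>y. ln C / y + eta_weight X * (ln (D y) / y) + e) \<longlongrightarrow> e) at_top" for C
  proof -
    have "((\<lambda>y. ln C / y + eta_weight X * (ln (D y) / y) + e) \<longlongrightarrow> 0 + eta_weight X * 0 + e) at_top"
      by (intro tendsto_add tendsto_mult lnD tendsto_const tendsto_divide_0[OF tendsto_const] filterlim_at_top_imp_at_infinity filterlim_ident)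
    thus ?thesis by simp
  qed
  have ln: "ln (C * (exp (e * y) * D y powr eta_weight X)) / y = ln C / y + eta_weight X * (ln (D y) / y) + e"
    if "C > 0" "y \<ge> 1" for C y
    using that D1[of y] by (simp add: ln_mult ln_powr field_simps)
  have "((\<lambda>y. ln (f y) / y) \<longlongrightarrow> e) at_top"
  proof (rule tendsto_sandwich[OF _ _ lim[of A] lim[of B]])
    have low: "A * (exp (e * y) * D y powr eta_weight X) \<le> f y" and upp: "f y \<le> B * (exp (e * y) * D y powr eta_weight X)"
      if "y \<ge> 1" for y
      using AB(3,4)[of "\<i> * of_real y"] that by (simp_all add: f_def D_def e_def)
    have pos: "0 < C * (exp (e * y) * D y powr eta_weight X)" if "C > 0" for C y using that D1[of y] by auto
    show "eventually (\<lambda>y. ln A / y + eta_weight X * (ln (D y) / y) + e \<le> ln (f y) / y) at_top"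
      using eventually_ge_at_top[of 1]
    proof eventually_elim
      case (elim y)
      have "ln (A * (exp (e * y) * D y powr eta_weight X)) \<le> ln (f y)"
        using low[OF elim] pos[OF AB(1), of y] by (subst ln_le_cancel_iff) auto
      thus ?case unfolding ln[OF AB(1) elim, symmetric] using elim by (intro divide_right_mono) auto
    qed
    show "eventually (\<lambda>y. ln (f y) / y \<le> ln B / y + eta_weight X * (ln (D y) / y) + e) at_top"
      using eventually_ge_at_top[of 1]
    proof eventually_elim
      case (elim y)
      have "ln (f y) \<le> ln (B * (exp (e * y) * D y powr eta_weight X))"
        using low[OF elim] upp[OF elim] pos[OF AB(1), of y] pos[OF AB(2), of y] by (subst ln_le_cancel_iff) auto
      thus ?case unfolding ln[OF AB(2) elim, symmetric] using elim by (intro divide_right_mono) auto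
    qed
  qed
  thus ?thesis by (simp only: f_def e_def)
qed

text \<open>This converts a factorization, which is an identity of functions, into linear equations
  for the exponents. Logarithmic growth rates add under multiplication.\<close>

lemma eta_order_mult:
  assumes X: "eta_exponents X" and Y: "eta_exponents Y" and Z: "eta_exponents Z"
    and eq: "\<And>z. z \<in> upper_half_plane \<Longrightarrow> eta_quotient X z = eta_quotient Y z * eta_quotient Z z"
  shows "eta_order X s = eta_order Y s + eta_order Z s"
proof -
  define w where "w y = \<i> * of_real y / (of_nat s * (\<i> * of_real y) + 1)" for y
  have "((\<lambda>y. ln (norm (eta_quotient Y (w y))) / y + ln (norm (eta_quotient Z (w y))) / y) \<longlongrightarrow>
      - (pi / 12) * eta_order Y s + - (pi / 12) * eta_order Z s) at_top"
    unfolding w_def by (intro tendsto_add ln_eta_quotient_limit Y Z)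
  moreover have "eventually (\<lambda>y. ln (norm (eta_quotient X (w y))) / y =
      ln (norm (eta_quotient Y (w y))) / y + ln (norm (eta_quotient Z (w y))) / y) at_top"
    using eventually_ge_at_top[of 1]
  proof eventually_elim
    case (elim y)
    have "Im (w y) = Im ((of_int 1 * (\<i> * of_real y) + of_int 0) / (of_int (int s) * (\<i> * of_real y) + of_int 1))"
      by (simp add: w_def)
    also have "\<dots> > 0" unfolding Im_moebius
      using elim moebius_denominator_nonzero[of "\<i> * of_real y" 1 1 0 "int s"] by (intro divide_pos_pos) auto
    finally have Im: "Im (w y) > 0" .
    hence "eta_quotient X (w y) = eta_quotient Y (w y) * eta_quotient Z (w y)"
      by (intro eq) (simp add: upper_half_plane_def)
    thus ?case using eta_quotient_nonzero[OF Y Im] eta_quotient_nonzero[OF Z Im]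
      by (simp add: norm_mult ln_mult add_divide_distrib)
  qed
  ultimately have "((\<lambda>y. ln (norm (eta_quotient X (w y))) / y) \<longlongrightarrow>
      - (pi / 12) * eta_order Y s + - (pi / 12) * eta_order Z s) at_top"
    by (simp add: filterlim_cong)
  moreover have "((\<lambda>y. ln (norm (eta_quotient X (w y))) / y) \<longlongrightarrow> - (pi / 12) * eta_order X s) at_top"
    unfolding w_def by (rule ln_eta_quotient_limit[OF X])
  ultimately have "- (pi / 12) * eta_order Y s + - (pi / 12) * eta_order Z s = - (pi / 12) * eta_order X s"
    using tendsto_unique[of at_top] by force
  hence "- (pi / 12) * (eta_order Y s + eta_order Z s) = - (pi / 12) * eta_order X s"
    by (simp only: distrib_left)
  thus ?thesis by simp
qed

section \<open>Primewise inversion of the order matrix\<close>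

text \<open>The total and all cusp orders are values of this one bilinear form, so the reduction to
  a single prime is proved once for both.\<close>

definition pairing :: "(nat \<Rightarrow> real) \<Rightarrow> (nat \<Rightarrow> real) \<Rightarrow> real" where
  "pairing f g = (\<Sum>d | f d \<noteq> 0. f d * g d)"

definition finitely_supported :: "(nat \<Rightarrow> real) \<Rightarrow> bool" where
  "finitely_supported f \<longleftrightarrow> finite {d. f d \<noteq> 0} \<and> f 0 = 0"

lemma cusp_order_conv_pairing: "cusp_order f s = pairing f (\<lambda>d. (real (gcd d s))\<^sup>2 / real d)"
  by (simp add: cusp_order_def pairing_def)

lemma pairing_superset:
  assumes "finite A" "\<And>d. f d \<noteq> 0 \<Longrightarrow> d \<in> A"
  shows "pairing f g = (\<Sum>d\<in>A. f d * g d)"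
  unfolding pairing_def using assms by (intro sum.mono_neutral_left) auto

lemma pairing_cong:
  assumes "\<And>d. f d \<noteq> 0 \<Longrightarrow> g d = h d"
  shows "pairing f g = pairing f h"
  unfolding pairing_def using assms by (intro sum.cong) auto

lemma pairing_mult_right: "pairing f (\<lambda>d. c * g d) = c * pairing f g"
  by (simp add: pairing_def sum_distrib_left mult_ac)

lemma pairing_add:
  assumes "finitely_supported f" "finitely_supported h"
  shows "pairing (\<lambda>d. a * f d + b * h d) g = a * pairing f g + b * pairing h g"
proof -
  define A where "A = {d. f d \<noteq> 0} \<union> {d. h d \<noteq> 0}"
  have A: "finite A" using assms by (simp add: A_def finitely_supported_def)
  have "pairing (\<lambda>d. a * f d + b * h d) g = (\<Sum>d\<in>A. (a * f d + b * h d) * g d)"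
    by (rule pairing_superset[OF A]) (auto simp: A_def)
  also have "\<dots> = a * (\<Sum>d\<in>A. f d * g d) + b * (\<Sum>d\<in>A. h d * g d)"
    by (simp add: sum_distrib_left sum.distrib algebra_simps)
  also have "(\<Sum>d\<in>A. f d * g d) = pairing f g"
    by (rule pairing_superset[OF A, symmetric]) (auto simp: A_def)
  also have "(\<Sum>d\<in>A. h d * g d) = pairing h g"
    by (rule pairing_superset[OF A, symmetric]) (auto simp: A_def)
  finally show ?thesis .
qed

lemma finitely_supported_add:
  assumes "finitely_supported f" "finitely_supported h"
  shows "finitely_supported (\<lambda>d. a * f d + b * h d)"
  using assms unfolding finitely_supported_def
  by (auto intro: finite_subset[of _ "{d. f d \<noteq> 0} \<union> {d. h d \<noteq> 0}"])

lemma pairing_sum: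
  assumes "finite I" "\<And>i. i \<in> I \<Longrightarrow> finitely_supported (F i)"
  shows "pairing (\<lambda>d. \<Sum>i\<in>I. F i d) g = (\<Sum>i\<in>I. pairing (F i) g)"
proof -
  define A where "A = (\<Union>i\<in>I. {d. F i d \<noteq> 0})"
  have A: "finite A" using assms by (auto simp: A_def finitely_supported_def)
  have "pairing (\<lambda>d. \<Sum>i\<in>I. F i d) g = (\<Sum>d\<in>A. (\<Sum>i\<in>I. F i d) * g d)"
    by (rule pairing_superset[OF A]) (auto simp: A_def dest: sum.not_neutral_contains_not_neutral)
  also have "\<dots> = (\<Sum>i\<in>I. \<Sum>d\<in>A. F i d * g d)"
    by (simp add: sum_distrib_right) (rule sum.swap)
  also have "\<dots> = (\<Sum>i\<in>I. pairing (F i) g)"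
    by (intro sum.cong refl pairing_superset[OF A, symmetric]) (auto simp: A_def)
  finally show ?thesis .
qed

lemma finitely_supported_sum:
  assumes "finite I" "\<And>i. i \<in> I \<Longrightarrow> finitely_supported (F i)"
  shows "finitely_supported (\<lambda>d. \<Sum>i\<in>I. F i d)"
proof -
  have "{d. (\<Sum>i\<in>I. F i d) \<noteq> 0} \<subseteq> (\<Union>i\<in>I. {d. F i d \<noteq> 0})"
    by (auto dest: sum.not_neutral_contains_not_neutral)
  moreover have "finite (\<Union>i\<in>I. {d. F i d \<noteq> 0})" using assms by (auto simp: finitely_supported_def)
  ultimately show ?thesis using assms by (auto simp: finitely_supported_def dest: finite_subset)
qed

text \<open>The part of f on indices whose p-component is exactly p^i, moved to the prime-to-p
  component. Setting it to 0 at multiples of p makes the decomposition into slices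
  unambiguous.\<close>

definition slice :: "nat \<Rightarrow> nat \<Rightarrow> (nat \<Rightarrow> real) \<Rightarrow> nat \<Rightarrow> real" where
  "slice p i f m = (if p dvd m then 0 else f (p ^ i * m))"

lemma finitely_supported_slice:
  assumes "prime p" "finitely_supported f"
  shows "finitely_supported (slice p i f)"
proof -
  have "inj (\<lambda>m. p ^ i * m)" using prime_gt_0_nat[OF assms(1)] by (auto simp: inj_def)
  hence "finite ((\<lambda>m. p ^ i * m) -` {d. f d \<noteq> 0})"
    using assms(2) by (intro finite_vimageI) (auto simp: finitely_supported_def)
  thus ?thesis unfolding finitely_supported_def
    by (auto simp: slice_def elim!: rev_finite_subset)
qed

text \<open>A nonzero slice needs i < p^i <= d for some d in the support. The lower bound
  \<open>n0\<close> allows a cutoff of at least j + 1, so that a full local vector fits below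
  it.\<close>

lemma slices_eventually_zero:
  assumes "prime p" "finitely_supported f"
  shows "\<exists>n\<ge>n0. \<forall>i>n. \<forall>m. slice p i f m = 0"
proof (intro exI[of _ "max n0 (Max (insert 0 {d. f d \<noteq> 0}))"] conjI allI impI)
  fix i m assume i: "i > max n0 (Max (insert 0 {d. f d \<noteq> 0}))"
  show "slice p i f m = 0"
  proof (rule ccontr)
    assume "slice p i f m \<noteq> 0"
    hence m: "m > 0" "f (p ^ i * m) \<noteq> 0" by (auto simp: slice_def split: if_splits intro: Nat.gr0I)
    have "i < p ^ i" using prime_gt_Suc_0_nat[OF assms(1)] by (rule power_gt_expt)
    also have "p ^ i \<le> p ^ i * m" using m by simp
    also have "\<dots> \<le> Max (insert 0 {d. f d \<noteq> 0})"
      using assms(2) m by (intro Max_ge) (auto simp: finitely_supported_def)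
    finally show False using i by simp
  qed
qed simp

lemma multiplicity_prime_power_mult:
  assumes "prime (p::nat)" "\<not> p dvd m"
  shows "multiplicity p (p ^ i * m) = i"
  using assms by (subst prime_elem_multiplicity_mult_distrib)
    (auto simp: not_dvd_imp_multiplicity_0 prime_gt_0_nat intro: Nat.gr0I)

lemma prime_power_decomposition:
  assumes "prime (p::nat)" "d > 0"
  obtains i m where "d = p ^ i * m" "\<not> p dvd m" "m > 0"
proof -
  obtain m where "d = p ^ multiplicity p d * m" "\<not> p dvd m"
    by (rule multiplicity_decompose'[of d p]) (use assms in auto)
  moreover from this have "m > 0" by (auto intro: Nat.gr0I)
  ultimately show thesis using that by blast
qed

lemma pairing_slices:
  assumes p: "prime p" and f: "finitely_supported f" and n: "\<forall>i>n. \<forall>m. slice p i f m = 0"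
  shows "pairing f g = (\<Sum>i\<le>n. pairing (slice p i f) (\<lambda>m. g (p ^ i * m)))"
proof -
  obtain B where B: "\<And>d. f d \<noteq> 0 \<Longrightarrow> d \<le> B"
    using f finite_nat_set_iff_bounded_le[of "{d. f d \<noteq> 0}"] by (auto simp: finitely_supported_def)
  define A where "A = {m. m \<le> B \<and> \<not> p dvd m}"
  have A: "finite A" by (simp add: A_def)
  have "(\<Sum>i\<le>n. pairing (slice p i f) (\<lambda>m. g (p ^ i * m))) = (\<Sum>i\<le>n. \<Sum>m\<in>A. f (p ^ i * m) * g (p ^ i * m))"
  proof (rule sum.cong [OF refl])
    fix i
    have "pairing (slice p i f) (\<lambda>m. g (p ^ i * m)) = (\<Sum>m\<in>A. slice p i f m * g (p ^ i * m))"
    proof (rule pairing_superset[OF A])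
      fix m assume m: "slice p i f m \<noteq> 0"
      hence "p ^ i * m \<le> B" by (intro B) (auto simp: slice_def split: if_splits)
      moreover have "m \<le> p ^ i * m" using prime_gt_0_nat[OF p] by simp
      ultimately have "m \<le> B" by (rule order_trans[rotated])
      thus "m \<in> A" using m by (auto simp: A_def slice_def split: if_splits)
    qed
    also have "\<dots> = (\<Sum>m\<in>A. f (p ^ i * m) * g (p ^ i * m))"
      by (intro sum.cong) (auto simp: A_def slice_def)
    finally show "pairing (slice p i f) (\<lambda>m. g (p ^ i * m)) = (\<Sum>m\<in>A. f (p ^ i * m) * g (p ^ i * m))" .
  qed
  also have "\<dots> = (\<Sum>(i, m)\<in>{..n} \<times> A. f (p ^ i * m) * g (p ^ i * m))"
    by (rule sum.cartesian_product)
  also have "\<dots> = (\<Sum>d\<in>(\<lambda>(i, m). p ^ i * m) ` ({..n} \<times> A). f d * g d)"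
  proof (subst sum.reindex)
    show "inj_on (\<lambda>(i, m). p ^ i * m) ({..n} \<times> A)"
    proof (rule inj_onI, clarify)
      fix i m i' m' assume "m \<in> A" "m' \<in> A" and eq: "p ^ i * m = p ^ i' * m'"
      hence "i = i'" using multiplicity_prime_power_mult[OF p, of m i] multiplicity_prime_power_mult[OF p, of m' i']
        by (simp add: A_def)
      thus "i = i' \<and> m = m'" using eq prime_gt_0_nat[OF p] by simp
    qed
  qed (simp add: case_prod_unfold)
  also have "\<dots> = pairing f g"
  proof (rule pairing_superset[symmetric])
    fix d assume d: "f d \<noteq> 0"
    hence "d > 0" using f by (auto simp: finitely_supported_def intro: Nat.gr0I)
    then obtain i m where im: "d = p ^ i * m" "\<not> p dvd m" "m > 0" by (rule prime_power_decomposition[OF p])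
    have "slice p i f m \<noteq> 0" using d im by (simp add: slice_def)
    hence "i \<le> n" using n not_le by blast
    moreover have "m \<le> p ^ i * m" using prime_gt_0_nat[OF p] by simp
    hence "m \<le> B" using B[OF d] im(1) by (metis order_trans)
    hence "m \<in> A" using im by (simp add: A_def)
    ultimately show "d \<in> (\<lambda>(i, m). p ^ i * m) ` ({..n} \<times> A)" using im by force
  qed (simp add: A_def)
  finally show ?thesis ..
qed

lemma gcd_prime_power_mult:
  assumes p: "prime (p::nat)" and "\<not> p dvd m" "\<not> p dvd s"
  shows "gcd (p ^ i * m) (p ^ k * s) = p ^ min i k * gcd m s"
proof -
  have *: "gcd (p ^ i * m) (p ^ k * s) = p ^ i * gcd m s"
    if "i \<le> k" "\<not> p dvd m" for i k m s
  proof -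
    have "p ^ k * s = p ^ i * (p ^ (k - i) * s)" using that by (simp flip: power_add mult.assoc)
    hence "gcd (p ^ i * m) (p ^ k * s) = p ^ i * gcd m (p ^ (k - i) * s)"
      by (simp only: gcd_mult_distrib_nat)
    moreover have "coprime m (p ^ (k - i))"
      using prime_imp_coprime[OF p that(2)] by (simp add: coprime_commute)
    ultimately show ?thesis by (simp add: gcd_mult_right_left_cancel)
  qed
  show ?thesis
  proof (cases "i \<le> k")
    case True
    thus ?thesis using *[of i k m s] assms by simp
  next
    case False
    thus ?thesis using *[of k i s m] assms by (simp add: gcd.commute)
  qed
qed

text \<open>The kernel gcd(d,s)^2 / d is multiplicative over coprime components. The order matrix is
  therefore a tensor product, whose factor at p has the entries p^(2 min(i,k)) / p^i.\<close>

lemma cusp_order_slices: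
  assumes p: "prime p" and f: "finitely_supported f" and n: "\<forall>i>n. \<forall>m. slice p i f m = 0"
    and s: "\<not> p dvd s"
  shows "cusp_order f (p ^ k * s) = (\<Sum>i\<le>n. real p ^ (2 * min i k) / real p ^ i * cusp_order (slice p i f) s)"
proof -
  have "pairing (slice p i f) (\<lambda>m. (real (gcd (p ^ i * m) (p ^ k * s)))\<^sup>2 / real (p ^ i * m)) =
      real p ^ (2 * min i k) / real p ^ i * pairing (slice p i f) (\<lambda>m. (real (gcd m s))\<^sup>2 / real m)" for i
    unfolding pairing_mult_right [symmetric]
  proof (rule pairing_cong)
    fix m assume "slice p i f m \<noteq> 0"
    hence "\<not> p dvd m" by (auto simp: slice_def split: if_splits)
    thus "(real (gcd (p ^ i * m) (p ^ k * s)))\<^sup>2 / real (p ^ i * m) =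
        real p ^ (2 * min i k) / real p ^ i * ((real (gcd m s))\<^sup>2 / real m)"
      by (subst gcd_prime_power_mult[OF p _ s]) (simp_all add: power_mult_distrib mult.commute flip: power_mult)
  qed
  moreover have "cusp_order f (p ^ k * s) =
      (\<Sum>i\<le>n. pairing (slice p i f) (\<lambda>m. (real (gcd (p ^ i * m) (p ^ k * s)))\<^sup>2 / real (p ^ i * m)))"
    unfolding cusp_order_conv_pairing by (rule pairing_slices[OF p f n])
  ultimately show ?thesis by (simp only: cusp_order_conv_pairing)
qed

text \<open>Slices at p and their linear combinations thus need testing only at cusps with s prime
  to p.\<close>

lemma cusp_order_prime_power_cancel:
  assumes p: "prime p" and f: "\<And>m. p dvd m \<Longrightarrow> f m = 0" and s: "\<not> p dvd s"
  shows "cusp_order f (p ^ k * s) = cusp_order f s"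
  unfolding cusp_order_conv_pairing
proof (rule pairing_cong)
  fix d assume "f d \<noteq> 0"
  hence "\<not> p dvd d" using f by blast
  thus "(real (gcd d (p ^ k * s)))\<^sup>2 / real d = (real (gcd d s))\<^sup>2 / real d"
    using gcd_prime_power_mult[OF p _ s, of d 0 k] by simp
qed

section \<open>The linear system at a single prime\<close>

text \<open>
  The matrix with entries \<open>P ^ (2 * min i k) / P ^ i\<close> becomes bidiagonal in the tail sums \<open>T\<close>.
\<close>

lemma local_system_tails:
  fixes u v :: "nat \<Rightarrow> real"
  assumes P: "P > 1" and v: "\<forall>i>n. v i = 0"
    and u: "\<And>k. u k = (\<Sum>i\<le>n. P ^ (2 * min i k) / P ^ i * v i)"
  obtains T where "\<And>k. k > n \<Longrightarrow> T k = 0" "\<And>k. v k = P ^ k * (T k - T (Suc k))" "u 0 = T 0"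
    "\<And>k. u (Suc k) = u k + (P\<^sup>2 - 1) * P ^ (2 * k) * T (Suc k)"
proof (rule that)
  define T where "T k = (\<Sum>i\<in>{k..n}. v i / P ^ i)" for k
  show "T k = 0" if "k > n" for k using that by (simp add: T_def)
  show "v k = P ^ k * (T k - T (Suc k))" for k
  proof (cases "k \<le> n")
    case True
    hence "T k = v k / P ^ k + T (Suc k)" by (simp add: T_def sum.atLeast_Suc_atMost)
    thus ?thesis using P by simp
  qed (use v in \<open>simp add: T_def\<close>)
  show "u 0 = T 0" by (simp add: u T_def atLeast0AtMost)
  show "u (Suc k) = u k + (P\<^sup>2 - 1) * P ^ (2 * k) * T (Suc k)" for k
  proof -
    have "u (Suc k) - u k = (\<Sum>i\<le>n. (P ^ (2 * min i (Suc k)) - P ^ (2 * min i k)) / P ^ i * v i)"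
      unfolding u sum_subtractf [symmetric] by (simp add: diff_divide_distrib left_diff_distrib)
    \<comment> \<open>For i <= k both minima equal i, so those terms cancel.\<close>
    also have "\<dots> = (\<Sum>i\<in>{Suc k..n}. (P ^ (2 * min i (Suc k)) - P ^ (2 * min i k)) / P ^ i * v i)"
      by (intro sum.mono_neutral_right) (auto simp: min_def not_le)
    also have "\<dots> = (\<Sum>i\<in>{Suc k..n}. (P\<^sup>2 - 1) * P ^ (2 * k) * (v i / P ^ i))"
    proof (rule sum.cong [OF refl])
      fix i assume "i \<in> {Suc k..n}"
      hence "min i (Suc k) = Suc k" "min i k = k" by auto
      moreover have "P ^ (2 * Suc k) = P\<^sup>2 * P ^ (2 * k)" by (simp add: power2_eq_square)
      moreover have "(a * X - X) / Y * w = (a - 1) * X * (w / Y)" for a X Y w :: real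
        by (simp add: left_diff_distrib)
      ultimately show "(P ^ (2 * min i (Suc k)) - P ^ (2 * min i k)) / P ^ i * v i = (P\<^sup>2 - 1) * P ^ (2 * k) * (v i / P ^ i)"
        by (simp only:)
    qed
    also have "\<dots> = (P\<^sup>2 - 1) * P ^ (2 * k) * T (Suc k)" by (simp add: T_def sum_distrib_left)
    finally show ?thesis by simp
  qed
qed

text \<open>Abel summation writes the sum of the \<open>v i\<close> as a combination of the \<open>u i\<close> with positive coefficients.\<close>

lemma local_system_positive:
  fixes u v :: "nat \<Rightarrow> real"
  assumes P: "P > 1" and v: "\<forall>i>n. v i = 0"
    and u: "\<And>k. u k = (\<Sum>i\<le>n. P ^ (2 * min i k) / P ^ i * v i)" and nonneg: "\<And>k. u k \<ge> 0"
  shows "(\<Sum>i\<le>n. v i) \<ge> 0" "(\<Sum>i\<le>n. v i) = 0 \<Longrightarrow> v i = 0"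
proof -
  obtain T where T: "\<And>k. k > n \<Longrightarrow> T k = 0" "\<And>k. v k = P ^ k * (T k - T (Suc k))" "u 0 = T 0"
    "\<And>k. u (Suc k) = u k + (P\<^sup>2 - 1) * P ^ (2 * k) * T (Suc k)"
    using local_system_tails[OF P v u] by blast
  \<comment> \<open>The value at N + 1 solves \<open>\<kappa> (Suc N) * (u (Suc N) - u N) = (P ^ Suc
    N - P ^ N) * T (Suc N)\<close>, and the value 1 at 0 matches \<open>u 0 = T 0\<close>. The
    sequence is positive and strictly decreasing, which makes all coefficients of the Abel sum
    positive.\<close>
  define \<kappa> where "\<kappa> i = (case i of 0 \<Rightarrow> 1 | Suc i \<Rightarrow> 1 / ((P + 1) * P ^ i))" for i
  have \<kappa>_pos: "\<kappa> i > 0" for i using P by (auto simp: \<kappa>_def split: nat.split)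
  have \<kappa>_dec: "\<kappa> (Suc i) < \<kappa> i" for i
  proof (cases i)
    case (Suc k)
    have "1 * ((P + 1) * P ^ k) < P * ((P + 1) * P ^ k)" using P by (intro mult_strict_right_mono) auto
    thus ?thesis using P Suc by (simp add: \<kappa>_def divide_strict_left_mono mult_ac)
  qed (use P in \<open>simp add: \<kappa>_def\<close>)
  have abel: "(\<Sum>i\<le>N. v i) = (\<Sum>i<N. (\<kappa> i - \<kappa> (Suc i)) * u i) + \<kappa> N * u N - P ^ N * T (Suc N)" for N
  proof (induction N)
    case 0
    show ?case by (simp add: T(2)[of 0] T(3) \<kappa>_def)
  next
    case (Suc N)
    have "\<kappa> (Suc N) * (u (Suc N) - u N) = (P ^ Suc N - P ^ N) * T (Suc N)"
    proof -
      have "(P\<^sup>2 - 1) * P ^ (2 * N) = (P - 1) * P ^ N * ((P + 1) * P ^ N)"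
      proof -
        have "P ^ (2 * N) = P ^ N * P ^ N" by (simp add: mult_2 power_add)
        moreover have "P\<^sup>2 - 1 = (P - 1) * (P + 1)" by (simp add: algebra_simps power2_eq_square)
        ultimately show ?thesis by (simp only: mult_ac)
      qed
      moreover have "(P + 1) * P ^ N \<noteq> 0" using P by simp
      ultimately have "\<kappa> (Suc N) * ((P\<^sup>2 - 1) * P ^ (2 * N)) = (P - 1) * P ^ N" by (simp add: \<kappa>_def)
      moreover have "\<kappa> (Suc N) * (u (Suc N) - u N) = \<kappa> (Suc N) * ((P\<^sup>2 - 1) * P ^ (2 * N)) * T (Suc N)"
        using T(4)[of N] by simp
      ultimately show ?thesis by (simp add: left_diff_distrib)
    qed
    thus ?case using Suc.IH T(2)[of "Suc N"] by (simp add: algebra_simps)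
  qed
  have nn: "0 \<le> (\<kappa> i - \<kappa> (Suc i)) * u i" for i using \<kappa>_dec[of i] nonneg[of i] by simp
  have sum: "(\<Sum>i\<le>n. v i) = (\<Sum>i<n. (\<kappa> i - \<kappa> (Suc i)) * u i) + \<kappa> n * u n"
    using abel[of n] T(1)[of "Suc n"] by simp
  have nns: "0 \<le> (\<Sum>i<n. (\<kappa> i - \<kappa> (Suc i)) * u i)" "0 \<le> \<kappa> n * u n"
    using nn nonneg[of n] \<kappa>_pos[of n] by (auto intro!: sum_nonneg)
  show "(\<Sum>i\<le>n. v i) \<ge> 0" unfolding sum using nns by simp
  assume "(\<Sum>i\<le>n. v i) = 0"
  hence z: "(\<Sum>i<n. (\<kappa> i - \<kappa> (Suc i)) * u i) = 0" "\<kappa> n * u n = 0" using nns sum by linarith+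
  \<comment> \<open>A vanishing sum with positive coefficients kills u 0, ..., u n. The recursion of
    the u then kills all tails, and with them v.\<close>
  have u0: "u k = 0" if "k \<le> n" for k
  proof (cases "k = n")
    case True
    thus ?thesis using z(2) \<kappa>_pos[of n] by simp
  next
    case False
    hence "(\<kappa> k - \<kappa> (Suc k)) * u k = 0" using z(1) nn that by (subst (asm) sum_nonneg_eq_0_iff) auto
    thus ?thesis using \<kappa>_dec[of k] by simp
  qed
  have "T k = 0" for k
  proof (cases "k > n")
    case False
    show ?thesis
    proof (cases k)
      case (Suc l)
      hence "(P\<^sup>2 - 1) * P ^ (2 * l) * T (Suc l) = 0" using T(4)[of l] u0[of l] u0[of "Suc l"] False by simp
      moreover have "P\<^sup>2 > 1" using P by (simp add: one_less_power)
      ultimately show ?thesis using P Suc by simp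
    qed (use T(3) u0[of 0] in simp)
  qed (use T in blast)
  thus "v i = 0" using T(2) by simp
qed

text \<open>If u lives at j only, the bidiagonal system leaves just the tails at j and j + 1, linked
  by u (j + 1) = 0. This makes v proportional to the local vector. The result is stated as
  homogeneous linear relations so that it can be applied at every s separately and then transferred
  from the orders of slices to the slices.\<close>

lemma local_system_solution:
  fixes u v :: "nat \<Rightarrow> real"
  assumes P: "P > 1" and v: "\<forall>i>n. v i = 0"
    and u: "\<And>k. u k = (\<Sum>i\<le>n. P ^ (2 * min i k) / P ^ i * v i)" and zero: "\<forall>k. k \<noteq> j \<longrightarrow> u k = 0"
  shows "j = 0 \<Longrightarrow> v 0 + P * v 1 = 0" "j = Suc l \<Longrightarrow> v l - v (l + 2) = 0"
    "j = Suc l \<Longrightarrow> P * v (l + 1) + (P\<^sup>2 + 1) * v l = 0"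
    "i + 1 < j \<or> j + 1 < i \<Longrightarrow> v i = 0"
proof -
  obtain T where T: "\<And>k. k > n \<Longrightarrow> T k = 0" "\<And>k. v k = P ^ k * (T k - T (Suc k))" "u 0 = T 0"
    "\<And>k. u (Suc k) = u k + (P\<^sup>2 - 1) * P ^ (2 * k) * T (Suc k)"
    using local_system_tails[OF P v u] by blast
  have P2: "P\<^sup>2 > 1" using P by (simp add: one_less_power)
  have T0: "T k = 0" if "k < j \<or> j + 1 < k" for k
  proof (cases k)
    case 0
    thus ?thesis using T(3) zero that by auto
  next
    case (Suc m)
    hence "(P\<^sup>2 - 1) * P ^ (2 * m) * T (Suc m) = 0" using T(4)[of m] zero that by auto
    thus ?thesis using P2 P Suc by simp
  qed
  show "v i = 0" if "i + 1 < j \<or> j + 1 < i" using that T(2)[of i] T0[of i] T0[of "Suc i"] by auto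
  show "v 0 + P * v 1 = 0" if "j = 0"
  proof -
    have "T 0 + (P\<^sup>2 - 1) * T 1 = 0" using T(3) T(4)[of 0] zero that by simp
    moreover have "T 2 = 0" using T0[of 2] that by simp
    ultimately show ?thesis using T(2)[of 0] T(2)[of 1] by (simp add: algebra_simps power2_eq_square numeral_2_eq_2)
  qed
  have rel: "T (l + 1) = - P\<^sup>2 * T (l + 2)" if "j = Suc l"
  proof -
    have "u j = (P\<^sup>2 - 1) * P ^ (2 * l) * T (l + 1)" using T(4)[of l] zero that by simp
    moreover have "0 = u j + (P\<^sup>2 - 1) * P ^ (2 * l) * (P\<^sup>2 * T (l + 2))"
      using T(4)[of "Suc l"] zero that by (simp add: mult_ac power2_eq_square)
    ultimately have "(P\<^sup>2 - 1) * P ^ (2 * l) * (T (l + 1) + P\<^sup>2 * T (l + 2)) = 0"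
      unfolding distrib_left by linarith
    thus ?thesis using P P2 by (simp add: add_eq_0_iff)
  qed
  show "v l - v (l + 2) = 0" if "j = Suc l"
    using T(2)[of l] T(2)[of "l + 2"] T0[of l] T0[of "l + 3"] rel that
    by (simp add: numeral_3_eq_3 numeral_2_eq_2 power_add algebra_simps)
  show "P * v (l + 1) + (P\<^sup>2 + 1) * v l = 0" if "j = Suc l"
  proof -
    have "v (l + 1) = P * P ^ l * (- P\<^sup>2 * T (l + 2) - T (l + 2))" "v l = P ^ l * (P\<^sup>2 * T (l + 2))"
      using T(2)[of l] T(2)[of "l + 1"] T0[of l] rel that by simp_all
    thus ?thesis by (simp only:) (simp add: algebra_simps power2_eq_square)
  qed
qed

section \<open>Positivity of the total and injectivity of the order map\<close>

text \<open>Induction over the primes: with s prime to p held fixed, the orders of the slices form a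
  local system at p. Nonnegativity and the equality case share one induction, as the equality case
  applies the hypothesis to single slices and their negatives.\<close>

lemma total_nonneg_if_prime_factors_subset:
  assumes "finitely_supported f" "finite Q" "\<And>p. p \<in> Q \<Longrightarrow> prime p"
    "\<And>d. f d \<noteq> 0 \<Longrightarrow> prime_factors d \<subseteq> Q" "\<And>s. s > 0 \<Longrightarrow> cusp_order f s \<ge> 0"
  shows "pairing f (\<lambda>_. 1) \<ge> 0 \<and> (pairing f (\<lambda>_. 1) = 0 \<longrightarrow> (\<forall>d. f d = 0))"
  using assms(2,1,3-)
proof (induction Q arbitrary: f rule: finite_induct)
  case empty
  have d1: "d = 1" if "f d \<noteq> 0" for d
  proof -
    have "d \<noteq> 0" using that empty.prems(1) by (metis finitely_supported_def)
    moreover have "prime_factors d = {}" using empty.prems(3) that by blast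
    ultimately show ?thesis by (auto simp: set_mset_eq_empty_iff prime_factorization_empty_iff)
  qed
  hence one: "pairing f g = f 1 * g 1" for g by (subst pairing_superset[of "{1}"]) auto
  show ?case
  proof (intro conjI impI allI)
    show "pairing f (\<lambda>_. 1) \<ge> 0" using empty.prems(4)[of 1] by (simp add: cusp_order_conv_pairing one)
    show "f d = 0" if "pairing f (\<lambda>_. 1) = 0" for d using that d1 by (auto simp: one)
  qed
next
  case (insert p Q)
  have p: "prime p" using insert by blast
  hence P: "real p > 1" using prime_gt_1_nat by simp
  note f = insert.prems(1)
  obtain n where n: "\<forall>i>n. \<forall>m. slice p i f m = 0"
    using slices_eventually_zero[OF p f, of 0] by auto
  have fs: "finitely_supported (slice p i f)" for i by (rule finitely_supported_slice[OF p f])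
  have sliceQ: "prime_factors m \<subseteq> Q" if "slice p i f m \<noteq> 0" for i m
  proof -
    have m: "\<not> p dvd m" "f (p ^ i * m) \<noteq> 0" using that by (auto simp: slice_def split: if_splits)
    hence nz: "p ^ i * m \<noteq> 0" using f unfolding finitely_supported_def by metis
    have "prime_factors m \<subseteq> prime_factors (p ^ i * m)" using nz by (intro dvd_prime_factors) auto
    also have "\<dots> \<subseteq> insert p Q" using insert.prems(3) m by blast
    finally show ?thesis using m(1) by auto
  qed
  \<comment> \<open>Summing over all powers of p removes p from the support and keeps the total.
    Local positivity says that the orders stay nonnegative.\<close>
  define V where "V m = (\<Sum>i\<le>n. slice p i f m)" for m
  have V: "finitely_supported V" unfolding V_def by (intro finitely_supported_sum fs) auto
  have slice_dvd: "slice p i f m = 0" if "p dvd m" for i m using that by (simp add: slice_def)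
  have V_dvd: "V m = 0" if "p dvd m" for m using that by (simp add: V_def slice_dvd)
  have VQ: "prime_factors m \<subseteq> Q" if "V m \<noteq> 0" for m
    using that sliceQ unfolding V_def by (meson sum.not_neutral_contains_not_neutral)
  have V_order: "cusp_order V s = (\<Sum>i\<le>n. cusp_order (slice p i f) s)" for s
    unfolding cusp_order_conv_pairing V_def by (rule pairing_sum) (auto intro: fs)
  have order0: "\<forall>i>n. cusp_order (slice p i f) s = 0" for s
    using n by (simp add: cusp_order_def)
  have local1: "(\<Sum>i\<le>n. cusp_order (slice p i f) s) \<ge> 0"
    and local2: "(\<Sum>i\<le>n. cusp_order (slice p i f) s) = 0 \<Longrightarrow> cusp_order (slice p i f) s = 0"
    if s: "s > 0" "\<not> p dvd s" for s i
  proof -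
    have nn: "0 \<le> cusp_order f (p ^ k * s)" for k using insert.prems(4) s(1) prime_gt_0_nat[OF p] by simp
    note pos = local_system_positive[OF P order0 cusp_order_slices[OF p f n s(2)] nn]
    show "(\<Sum>i\<le>n. cusp_order (slice p i f) s) \<ge> 0" by (rule pos(1))
    show "(\<Sum>i\<le>n. cusp_order (slice p i f) s) = 0 \<Longrightarrow> cusp_order (slice p i f) s = 0" by (rule pos(2))
  qed
  have V_nonneg: "cusp_order V s \<ge> 0" if "s > 0" for s
  proof -
    obtain k r where r: "s = p ^ k * r" "\<not> p dvd r" "r > 0" by (rule prime_power_decomposition[OF p \<open>s > 0\<close>])
    have "cusp_order V s = cusp_order V r"
      unfolding r(1) by (rule cusp_order_prime_power_cancel[OF p _ r(2)]) (rule V_dvd)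
    thus ?thesis using local1[OF r(3,2)] V_order[of r] by simp
  qed
  have IH: "pairing V (\<lambda>_. 1) \<ge> 0 \<and> (pairing V (\<lambda>_. 1) = 0 \<longrightarrow> (\<forall>d. V d = 0))"
    by (rule insert.IH[OF V _ VQ V_nonneg]) (use insert.prems(2) in blast)
  have "pairing V (\<lambda>_. 1) = (\<Sum>i\<le>n. pairing (slice p i f) (\<lambda>_. 1))"
    unfolding V_def by (rule pairing_sum) (auto intro: fs)
  also have "\<dots> = pairing f (\<lambda>_. 1)" by (rule pairing_slices[OF p f n, symmetric])
  finally have V_eq: "pairing V (\<lambda>_. 1) = pairing f (\<lambda>_. 1)" .
  have "f d = 0" if z: "pairing f (\<lambda>_. 1) = 0" for d
  proof (cases "d = 0")
    case False
    have "V m = 0" for m using IH V_eq z by simp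
    hence "cusp_order V s = 0" for s by (simp add: cusp_order_def)
    hence s0: "cusp_order (slice p i f) s = 0" if "s > 0" "\<not> p dvd s" for s i
      using local2[OF that] V_order by simp
    have s0': "cusp_order (slice p i f) s = 0" if "s > 0" for s i
    proof -
      obtain k r where r: "s = p ^ k * r" "\<not> p dvd r" "r > 0" by (rule prime_power_decomposition[OF p \<open>s > 0\<close>])
      have "cusp_order (slice p i f) s = cusp_order (slice p i f) r"
        unfolding r(1) by (rule cusp_order_prime_power_cancel[OF p _ r(2)]) (rule slice_dvd)
      thus ?thesis using s0[OF r(3,2)] by simp
    qed
    obtain i m where im: "d = p ^ i * m" "\<not> p dvd m" using prime_power_decomposition[OF p, of d] False by blast
    \<comment> \<open>The slice and its negative both have vanishing orders, so both totals are
      nonnegative; the total is then 0 and the slice vanishes. The summand with factor 0 brings the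
      negative into the form of \<open>pairing_add\<close>.\<close>
    define h where "h = (\<lambda>m. (-1) * slice p i f m + 0 * slice p i f m)"
    have h: "finitely_supported h" unfolding h_def by (intro finitely_supported_add fs)
    have hp: "pairing h g = - pairing (slice p i f) g" for g
      unfolding h_def using pairing_add[OF fs fs, of "-1" i 0 i g] by simp
    have "pairing h (\<lambda>_. 1) \<ge> 0"
      using insert.IH[OF h] insert.prems(2) sliceQ s0' by (simp add: cusp_order_conv_pairing hp) (simp add: h_def)
    moreover have IHs: "pairing (slice p i f) (\<lambda>_. 1) \<ge> 0 \<and> (pairing (slice p i f) (\<lambda>_. 1) = 0 \<longrightarrow> (\<forall>d. slice p i f d = 0))"
      by (rule insert.IH[OF fs _ sliceQ]) (use insert.prems(2) s0' in auto)
    ultimately have "slice p i f m = 0" by (simp add: hp)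
    thus ?thesis using im by (simp add: slice_def)
  qed (use f in \<open>simp add: finitely_supported_def\<close>)
  thus ?case using IH V_eq by auto
qed

lemma total_nonneg:
  assumes f: "finitely_supported f" and nonneg: "\<And>s. s > 0 \<Longrightarrow> cusp_order f s \<ge> 0"
  shows "pairing f (\<lambda>_. 1) \<ge> 0" "pairing f (\<lambda>_. 1) = 0 \<Longrightarrow> f d = 0"
proof -
  define Q where "Q = (\<Union>d\<in>{d. f d \<noteq> 0}. prime_factors d)"
  have "finite Q" "\<And>p. p \<in> Q \<Longrightarrow> prime p" "\<And>d. f d \<noteq> 0 \<Longrightarrow> prime_factors d \<subseteq> Q"
    using f by (auto simp: Q_def finitely_supported_def)
  from total_nonneg_if_prime_factors_subset[OF f this nonneg]
  show "pairing f (\<lambda>_. 1) \<ge> 0" "pairing f (\<lambda>_. 1) = 0 \<Longrightarrow> f d = 0" by auto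
qed

text \<open>Injectivity is a consequence of positivity: f and -f both have nonnegative orders, so
  the total of f is 0, and this happens only for f = 0.\<close>

lemma eq_zero_if_cusp_orders_zero:
  assumes f: "finitely_supported f" and zero: "\<And>s. s > 0 \<Longrightarrow> cusp_order f s = 0"
  shows "f d = 0"
proof -
  define h where "h = (\<lambda>m. (-1) * f m + 0 * f m)"
  have h: "finitely_supported h" unfolding h_def by (intro finitely_supported_add f)
  have hp: "pairing h g = - pairing f g" for g
    unfolding h_def using pairing_add[OF f f, of "-1" 0 g] by simp
  have "pairing f (\<lambda>_. 1) \<ge> 0" using total_nonneg(1)[OF f] zero by simp
  moreover have "pairing h (\<lambda>_. 1) \<ge> 0" using total_nonneg(1)[OF h] zero by (simp add: hp cusp_order_conv_pairing)
  ultimately have "pairing f (\<lambda>_. 1) = 0" by (simp add: hp)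
  thus ?thesis using total_nonneg(2)[OF f] zero by simp
qed

section \<open>Irreducible eta quotients\<close>

text \<open>Twice the weight, kept as an integer because irreducibility will be a matter of
  divisibility.\<close>

definition eta_total :: "(nat \<Rightarrow> int) \<Rightarrow> int" where
  "eta_total X = (\<Sum>d | X d \<noteq> 0. X d)"

lemma eta_weight_conv_total: "eta_weight X = of_int (eta_total X) / 2"
  by (simp add: eta_weight_def eta_total_def)

lemma of_int_eta_total: "real_of_int (eta_total X) = pairing (\<lambda>d. real_of_int (X d)) (\<lambda>_. 1)"
  by (simp add: eta_total_def pairing_def)

lemma finitely_supported_of_int_iff: "finitely_supported (\<lambda>d. real_of_int (X d)) \<longleftrightarrow> eta_exponents X"
  by (simp add: finitely_supported_def eta_exponents_def)

lemma pairing_scale: "pairing (\<lambda>d. a * f d) g = a * pairing f g"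
  by (cases "a = 0") (simp_all add: pairing_def sum_distrib_left mult_ac)

section \<open>The local vectors and the tensor products built from them\<close>

text \<open>
  Up to scaling, the column of the inverse order matrix of level \<open>p\<^sup>n\<close> that belongs to the cusp
  \<open>1 / p\<^sup>j\<close>; for \<open>j < n\<close> it does not depend on \<open>n\<close>.
\<close>

definition local_exponent :: "nat \<Rightarrow> nat \<Rightarrow> nat \<Rightarrow> int" where
  "local_exponent p j i =
     (if j = 0 then (if i = 0 then int p else if i = 1 then - 1 else 0)
      else if i = j then (int p)\<^sup>2 + 1 else if i + 1 = j \<or> i = j + 1 then - int p else 0)"

text \<open>The sum of the local vector: p - 1 for (p, -1) and p^2 + 1 - 2 p = (p - 1)^2 for (-p,
  p^2 + 1, -p). The first factors will form the totient of rad N, the second ones that of rad (gcd t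
  (N / t)).\<close>

definition local_weight :: "nat \<Rightarrow> nat \<Rightarrow> int" where
  "local_weight p j = (int p - 1) * (if j = 0 then 1 else int p - 1)"

lemma sum_local_exponent:
  fixes h :: "nat \<Rightarrow> real"
  assumes "n \<ge> j + 1"
  shows "j = 0 \<Longrightarrow> (\<Sum>i\<le>n. h i * of_int (local_exponent p j i)) = real p * h 0 - h 1"
    "j = Suc l \<Longrightarrow> (\<Sum>i\<le>n. h i * of_int (local_exponent p j i)) =
       ((real p)\<^sup>2 + 1) * h (l + 1) - real p * (h l + h (l + 2))"
proof -
  show "(\<Sum>i\<le>n. h i * of_int (local_exponent p j i)) = real p * h 0 - h 1" if "j = 0"
  proof -
    have "(\<Sum>i\<le>n. h i * of_int (local_exponent p j i)) = (\<Sum>i\<in>{0, 1}. h i * of_int (local_exponent p j i))"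
      using assms that by (intro sum.mono_neutral_right) (auto simp: local_exponent_def)
    thus ?thesis using that by (simp add: local_exponent_def)
  qed
  show "(\<Sum>i\<le>n. h i * of_int (local_exponent p j i)) = ((real p)\<^sup>2 + 1) * h (l + 1) - real p * (h l + h (l + 2))" if "j = Suc l"
  proof -
    have "(\<Sum>i\<le>n. h i * of_int (local_exponent p j i)) = (\<Sum>i\<in>{l, l + 1, l + 2}. h i * of_int (local_exponent p j i))"
      using assms that by (intro sum.mono_neutral_right) (auto simp: local_exponent_def)
    thus ?thesis using that by (simp add: local_exponent_def algebra_simps)
  qed
qed

definition local_order :: "nat \<Rightarrow> nat \<Rightarrow> nat \<Rightarrow> nat \<Rightarrow> real" where
  "local_order n p j k = (\<Sum>i\<le>n. real p ^ (2 * min i k) / real p ^ i * of_int (local_exponent p j i))"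

text \<open>For k < j the support of the vector sees the progression p^(2k - i), for k > j the
  progression p^i, and both are annihilated. For j = 0 only the second case occurs, and (p, -1)
  annihilates (1, p).\<close>

lemma local_order_eq_0:
  assumes "n \<ge> j + 1" "p > 1" "k \<noteq> j"
  shows "local_order n p j k = 0"
proof (cases j)
  case 0
  have "k \<noteq> 0" using assms 0 by simp
  hence "min 1 k = 1" by simp
  thus ?thesis unfolding local_order_def sum_local_exponent(1)[OF assms(1) 0]
    using assms(2) by (simp add: power2_eq_square)
next
  case (Suc l)
  show ?thesis
  proof (cases "k \<le> l")
    case True
    hence "min (l + 1) k = k" "min l k = k" "min (l + 2) k = k" by auto
    thus ?thesis unfolding local_order_def sum_local_exponent(2)[OF assms(1) Suc]
      using assms(2) by (simp add: field_simps power2_eq_square)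
  next
    case False
    hence m: "min (l + 1) k = l + 1" "min l k = l" "min (l + 2) k = l + 2" using assms(3) Suc by auto
    have e: "real p ^ (2 * i) / real p ^ i = real p ^ i" for i
      using assms(2) by (simp add: power_mult_distrib power2_eq_square mult_2 power_add)
    show ?thesis unfolding local_order_def sum_local_exponent(2)[OF assms(1) Suc] m e
      by (simp add: algebra_simps power2_eq_square)
  qed
qed

lemma local_order_pos:
  assumes "n \<ge> j + 1" "p > 1"
  shows "local_order n p j j > 0"
proof (cases j)
  case 0
  have "1 / real p < 1" using assms(2) by simp
  also have "1 < real p" using assms(2) by simp
  finally show ?thesis unfolding local_order_def sum_local_exponent(1)[OF assms(1) 0]
    using 0 by simp
next
  case (Suc l)
  have m: "min (l + 1) j = l + 1" "min l j = l" "min (l + 2) j = l + 1" using Suc by auto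
  have p: "real p > 1" using assms(2) by simp
  have "local_order n p j j = ((real p)\<^sup>2 + 1) * (real p ^ (2 * (l + 1)) / real p ^ (l + 1)) -
      real p * (real p ^ (2 * l) / real p ^ l + real p ^ (2 * (l + 1)) / real p ^ (l + 2))"
    unfolding local_order_def sum_local_exponent(2)[OF assms(1) Suc] m ..
  also have "\<dots> = real p ^ (l + 1) * ((real p)\<^sup>2 - 1)"
  proof -
    have "real p ^ (2 * l) = real p ^ l * real p ^ l" by (simp add: mult_2 power_add)
    thus ?thesis using p by (simp add: field_simps power2_eq_square)
  qed
  also have "\<dots> > 0" using p by (simp add: one_less_power)
  finally show ?thesis .
qed

lemma sum_local_exponent_eq:
  assumes "n \<ge> j + 1"
  shows "(\<Sum>i\<le>n. real_of_int (local_exponent p j i)) = of_int (local_weight p j)"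
proof (cases j)
  case 0
  thus ?thesis using sum_local_exponent(1)[OF assms 0, of "\<lambda>_. 1"] by (simp add: local_weight_def)
next
  case (Suc l)
  thus ?thesis using sum_local_exponent(2)[OF assms Suc, of "\<lambda>_. 1"]
    by (simp add: local_weight_def algebra_simps power2_eq_square)
qed

text \<open>A relation rather than an operation, because it is used in both directions: to build X
  from W, and to split a given Y.\<close>

definition local_product :: "nat \<Rightarrow> nat \<Rightarrow> (nat \<Rightarrow> int) \<Rightarrow> (nat \<Rightarrow> int) \<Rightarrow> bool" where
  "local_product p j W X \<longleftrightarrow> (\<forall>m. p dvd m \<longrightarrow> W m = 0) \<and>
     (\<forall>i m. \<not> p dvd m \<longrightarrow> X (p ^ i * m) = local_exponent p j i * W m)"

lemma local_product_slice:
  assumes "local_product p j W X"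
  shows "slice p i (\<lambda>d. real_of_int (X d)) = (\<lambda>m. of_int (local_exponent p j i) * of_int (W m))"
  using assms by (auto simp: local_product_def slice_def fun_eq_iff)

text \<open>\<open>C\<close> is \<open>local_order n p j\<close> for a cutoff n that depends on X.
  It is kept abstract because only its sign pattern matters: positive at j and 0 elsewhere.\<close>

lemma local_product_order_total:
  assumes p: "prime p" and X: "eta_exponents X" and prod: "local_product p j W X"
  obtains C where "\<And>k. k \<noteq> j \<Longrightarrow> C k = 0" "C j > 0"
    "\<And>k s. \<not> p dvd s \<Longrightarrow> eta_order X (p ^ k * s) = C k * eta_order W s"
    "eta_total X = local_weight p j * eta_total W"
proof -
  have fs: "finitely_supported (\<lambda>d. real_of_int (X d))" using X by (simp add: finitely_supported_of_int_iff)
  obtain n where n: "n \<ge> j + 1" "\<forall>i>n. \<forall>m. slice p i (\<lambda>d. real_of_int (X d)) m = 0"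
    using slices_eventually_zero[OF p fs, of "j + 1"] by auto
  have "eta_order X (p ^ k * s) = local_order n p j k * eta_order W s" if s: "\<not> p dvd s" for k s
    unfolding cusp_order_slices[OF p fs n(2) s] local_product_slice[OF prod]
    unfolding cusp_order_conv_pairing pairing_scale local_order_def sum_distrib_right
    by (simp only: mult.assoc)
  moreover have "eta_total X = local_weight p j * eta_total W"
  proof -
    have "real_of_int (eta_total X) = (\<Sum>i\<le>n. of_int (local_exponent p j i) * of_int (eta_total W))"
      unfolding of_int_eta_total pairing_slices[OF p fs n(2)] local_product_slice[OF prod] pairing_scale ..
    also have "\<dots> = of_int (local_weight p j * eta_total W)"
      by (simp add: sum_local_exponent_eq[OF n(1)] flip: sum_distrib_right)
    finally show ?thesis by (simp only: of_int_eq_iff)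
  qed
  ultimately show thesis
    using local_order_eq_0[OF n(1) prime_gt_1_nat[OF p]] local_order_pos[OF n(1) prime_gt_1_nat[OF p]]
    by (intro that[of "local_order n p j"]) auto
qed

text \<open>For each s prime to p the orders of the slices satisfy the relations of
  \<open>local_system_solution\<close>. By injectivity of the order map the slices satisfy them too,
  which is proportionality to the local vector. What remains is to find the multiplier W as an
  integral expression in Y.\<close>

lemma local_decomposition:
  assumes p: "prime p" and Y: "eta_exponents Y"
    and zero: "\<And>s. s > 0 \<Longrightarrow> multiplicity p s \<noteq> j \<Longrightarrow> eta_order Y s = 0"
  shows "\<exists>W. eta_exponents W \<and> local_product p j W Y"
proof -
  define y where "y = (\<lambda>d. real_of_int (Y d))"
  have fy: "finitely_supported y" using Y by (simp add: y_def finitely_supported_of_int_iff)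
  have fs: "finitely_supported (slice p i y)" for i by (rule finitely_supported_slice[OF p fy])
  have P: "real p > 1" using prime_gt_1_nat[OF p] by simp
  obtain n where n: "\<forall>i>n. \<forall>m. slice p i y m = 0"
    using slices_eventually_zero[OF p fy, of 0] by auto
  have order0: "\<forall>i>n. cusp_order (slice p i y) s = 0" for s
    using n by (simp add: cusp_order_def)
  have u0: "\<forall>k. k \<noteq> j \<longrightarrow> cusp_order y (p ^ k * s) = 0" if "\<not> p dvd s" "s > 0" for s
    using zero[of "p ^ k * s" for k] that multiplicity_prime_power_mult[OF p that(1)] prime_gt_0_nat[OF p]
    by (simp add: y_def)
  note sol = local_system_solution[OF P order0 cusp_order_slices[OF p fy n] u0]
  \<comment> \<open>A linear relation between two slices may be tested on their orders.\<close>
  have comb: "a * slice p i y m + b * slice p i' y m = 0"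
    if *: "\<And>s. \<not> p dvd s \<Longrightarrow> s > 0 \<Longrightarrow> a * cusp_order (slice p i y) s + b * cusp_order (slice p i' y) s = 0"
    for a b i i' m
  proof (rule eq_zero_if_cusp_orders_zero)
    show "finitely_supported (\<lambda>m. a * slice p i y m + b * slice p i' y m)"
      by (intro finitely_supported_add fs)
    fix s :: nat assume "s > 0"
    obtain k r where r: "s = p ^ k * r" "\<not> p dvd r" "r > 0" by (rule prime_power_decomposition[OF p \<open>s > 0\<close>])
    have "cusp_order (\<lambda>m. a * slice p i y m + b * slice p i' y m) s = cusp_order (\<lambda>m. a * slice p i y m + b * slice p i' y m) r"
      unfolding r(1) by (rule cusp_order_prime_power_cancel[OF p _ r(2)]) (simp add: slice_def)
    also have "\<dots> = 0" using *[OF r(2,3)]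
      by (simp add: cusp_order_conv_pairing pairing_add[OF fs fs])
    finally show "cusp_order (\<lambda>m. a * slice p i y m + b * slice p i' y m) s = 0" .
  qed
  have far: "Y (p ^ i * m) = 0" if "i + 1 < j \<or> j + 1 < i" "\<not> p dvd m" for i m
    using comb[of 1 i 0 i m] sol(4) that by (auto simp: slice_def y_def)
  have of_int: "real_of_int z = 0 \<Longrightarrow> z = 0" for z by simp
  show ?thesis
  proof (cases j)
    case 0
    \<comment> \<open>The entry -1 of (p, -1) at i = 1 lets the multiplier be read off
      directly.\<close>
    define W where "W m = (if p dvd m then 0 else - Y (p * m))" for m
    have "(\<lambda>m. real_of_int (W m)) = (\<lambda>m. (-1) * slice p 1 y m + 0 * slice p 1 y m)"
      by (auto simp: W_def slice_def y_def)
    hence "finitely_supported (\<lambda>m. real_of_int (W m))"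
      using finitely_supported_add[OF fs fs, of "-1" 1 0 1] by simp
    hence W: "eta_exponents W" by (simp add: finitely_supported_of_int_iff)
    have "Y (p ^ i * m) = local_exponent p j i * W m" if m: "\<not> p dvd m" for i m
    proof -
      have "real_of_int (Y m + int p * Y (p * m)) = 0"
        using comb[of 1 0 "real p" 1 m] sol(1)[OF _ _ _ 0] m by (simp add: slice_def y_def)
      hence "Y m + int p * Y (p * m) = 0" by (rule of_int)
      moreover have "Y (p ^ i * m) = 0" if "i > 1" using far[of i m] 0 m that by simp
      moreover consider "i = 0" | "i = 1" | "i > 1" by linarith
      ultimately show ?thesis using m 0 by cases (auto simp: local_exponent_def W_def)
    qed
    moreover have "W m = 0" if "p dvd m" for m using that by (simp add: W_def)
    ultimately show ?thesis using W unfolding local_product_def by blast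
  next
    case (Suc l)
    \<comment> \<open>Bezout for the entries p^2 + 1 at l + 1 and -p at l: (p^2 + 1) + p * (-p) = 1,
      so this combination returns the multiplier without any division.\<close>
    define W where "W m = (if p dvd m then 0 else Y (p ^ (l + 1) * m) + int p * Y (p ^ l * m))" for m
    have "(\<lambda>m. real_of_int (W m)) = (\<lambda>m. 1 * slice p (l + 1) y m + real p * slice p l y m)"
      by (auto simp: W_def slice_def y_def)
    hence "finitely_supported (\<lambda>m. real_of_int (W m))"
      using finitely_supported_add[OF fs fs, of 1 "l + 1" "real p" l] by simp
    hence W: "eta_exponents W" by (simp add: finitely_supported_of_int_iff)
    have "Y (p ^ i * m) = local_exponent p j i * W m" if m: "\<not> p dvd m" for i m
    proof -
      define y0 where "y0 = Y (p ^ l * m)"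
      define y1 where "y1 = Y (p ^ (l + 1) * m)"
      define y2 where "y2 = Y (p ^ (l + 2) * m)"
      have "real_of_int (y0 - y2) = 0"
        using comb[of 1 l "-1" "l + 2" m] sol(2)[OF _ _ _ Suc] m by (simp add: slice_def y_def y0_def y2_def)
      hence e2: "y2 = y0" using of_int[of "y0 - y2"] by simp
      have "real_of_int (int p * y1 + ((int p)\<^sup>2 + 1) * y0) = 0"
        using comb[of "real p" "l + 1" "(real p)\<^sup>2 + 1" l m] sol(3)[OF _ _ _ Suc] m
        by (simp add: slice_def y_def y0_def y1_def)
      hence e: "int p * y1 + ((int p)\<^sup>2 + 1) * y0 = 0" by (rule of_int)
      have e0: "y0 = - int p * (y1 + int p * y0)"
        using e by (simp add: algebra_simps power2_eq_square)
      have "((int p)\<^sup>2 + 1) * (y1 + int p * y0) = y1 + int p * (int p * y1 + ((int p)\<^sup>2 + 1) * y0)"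
        by (simp add: algebra_simps power2_eq_square)
      hence e1: "y1 = ((int p)\<^sup>2 + 1) * (y1 + int p * y0)" unfolding e by simp
      have Wm: "W m = y1 + int p * y0" using m by (simp add: W_def y0_def y1_def)
      consider "i = l" | "i = l + 1" | "i = l + 2" | "i + 1 < j \<or> j + 1 < i" using Suc by linarith
      thus ?thesis
      proof cases
        case 1
        thus ?thesis unfolding Wm using e0 Suc by (simp add: local_exponent_def flip: y0_def)
      next
        case 2
        hence "Y (p ^ i * m) = y1" by (simp only: y1_def)
        thus ?thesis unfolding Wm using e1 Suc 2 by (simp add: local_exponent_def)
      next
        case 3
        hence "Y (p ^ i * m) = y0" using e2 by (simp add: y2_def)
        thus ?thesis unfolding Wm using e0 Suc 3 by (simp add: local_exponent_def)
      next
        case 4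
        thus ?thesis using far[OF 4 m] by (auto simp: local_exponent_def)
      qed
    qed
    moreover have "W m = 0" if "p dvd m" for m using that by (simp add: W_def)
    ultimately show ?thesis using W unfolding local_product_def by blast
  qed
qed

section \<open>Combining the primes, and irreducibility\<close>

lemma multiplicity_other_prime_power:
  assumes "prime (p::nat)" "prime q" "p \<noteq> q" "s > 0"
  shows "multiplicity q (p ^ k * s) = multiplicity q s"
  using assms by (subst prime_elem_multiplicity_mult_distrib)
    (auto simp: prime_multiplicity_other prime_elem_multiplicity_power_distrib prime_gt_0_nat)

text \<open>Splitting off one prime after another writes Y as an integral multiple of the full
  tensor product. Y may have any level, since irreducibility concerns factorizations on all
  multiples of the level.\<close>

lemma local_weights_dvd_eta_total:
  assumes "finite Q" "\<And>p. p \<in> Q \<Longrightarrow> prime p" "eta_exponents Y"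
    "\<And>s p. s > 0 \<Longrightarrow> p \<in> Q \<Longrightarrow> multiplicity p s \<noteq> j p \<Longrightarrow> eta_order Y s = 0"
  shows "(\<Prod>p\<in>Q. local_weight p (j p)) dvd eta_total Y"
  using assms
proof (induction Q arbitrary: Y rule: finite_induct)
  case (insert p Q)
  have p: "prime p" using insert.prems(1) by blast
  obtain W where W: "eta_exponents W" "local_product p (j p) W Y"
    using local_decomposition[OF p insert.prems(2), of "j p"] insert.prems(3) by blast
  obtain C where C: "C (j p) > 0"
    "\<And>k s. \<not> p dvd s \<Longrightarrow> eta_order Y (p ^ k * s) = C k * eta_order W s"
    "eta_total Y = local_weight p (j p) * eta_total W"
    by (rule local_product_order_total[OF p insert.prems(2) W(2)]) blast
  have "(\<Prod>p\<in>Q. local_weight p (j p)) dvd eta_total W"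
  proof (rule insert.IH[OF _ W(1)])
    fix s q assume s: "s > 0" and q: "q \<in> Q" and mult: "multiplicity q s \<noteq> j q"
    have pq: "prime q" "p \<noteq> q" using q insert.prems(1) insert.hyps(2) by auto
    obtain k r where r: "s = p ^ k * r" "\<not> p dvd r" "r > 0" by (rule prime_power_decomposition[OF p s])
    \<comment> \<open>The p-part is changed to p^(j p), the only one at which \<open>C\<close> is
      nonzero, so that vanishing of the order of Y passes to W.\<close>
    have "multiplicity q (p ^ j p * r) \<noteq> j q"
      using mult unfolding r(1) by (simp add: multiplicity_other_prime_power[OF p pq r(3)])
    hence "eta_order Y (p ^ j p * r) = 0"
      using insert.prems(3)[of "p ^ j p * r" q] q r(3) prime_gt_0_nat[OF p] by simp
    hence "eta_order W r = 0" using C(2)[OF r(2)] C(1) by simp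
    moreover have "eta_order W s = eta_order W r"
      unfolding r(1) by (rule cusp_order_prime_power_cancel[OF p _ r(2)]) (use W(2) in \<open>simp add: local_product_def\<close>)
    ultimately show "eta_order W s = 0" by simp
  qed (use insert.prems(1) in blast)
  thus ?case using insert.hyps by (simp add: C(3) mult_dvd_mono)
qed simp

text \<open>Tensor products, one prime at a time. The last entry of each local vector, at j p + 1,
  is -1 or -p and never 0; hence the largest index survives in the product, which determines the
  level.\<close>

lemma exists_eta_quotient_vanishing_at_one_cusp:
  assumes "finite Q" "\<And>p. p \<in> Q \<Longrightarrow> prime p"
  shows "\<exists>X. eta_exponents X \<and> (\<forall>s>0. eta_order X s \<ge> 0) \<and>
    (\<forall>s>0. \<forall>p\<in>Q. multiplicity p s \<noteq> j p \<longrightarrow> eta_order X s = 0) \<and>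
    (\<forall>d. X d \<noteq> 0 \<longrightarrow> d dvd (\<Prod>p\<in>Q. p ^ (j p + 1))) \<and> X (\<Prod>p\<in>Q. p ^ (j p + 1)) \<noteq> 0 \<and>
    eta_total X = (\<Prod>p\<in>Q. local_weight p (j p))"
  using assms
proof (induction Q rule: finite_induct)
  case empty
  \<comment> \<open>The empty tensor product is eta itself, of order 1 at every s.\<close>
  define X :: "nat \<Rightarrow> int" where "X d = (if d = 1 then 1 else 0)" for d
  have supp: "{d. X d \<noteq> 0} = {1}" "{d. real_of_int (X d) \<noteq> 0} = {1}" by (auto simp: X_def)
  hence "eta_order X s = 1" for s by (simp add: cusp_order_def) (simp add: X_def)
  thus ?case using supp by (intro exI[of _ X]) (auto simp: eta_exponents_def eta_total_def X_def)
next
  case (insert p Q)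
  have p: "prime p" using insert.prems by blast
  define M where "M = (\<Prod>p\<in>Q. p ^ (j p + 1))"
  have pM: "\<not> p dvd M"
  proof
    assume "p dvd M"
    then obtain q where q: "q \<in> Q" "p dvd q ^ (j q + 1)"
      unfolding M_def prime_dvd_prod_iff[OF insert.hyps(1) p] by blast
    have "p dvd q" by (rule prime_dvd_power[OF p q(2)])
    hence "p = q" using p insert.prems q(1) by (intro primes_dvd_imp_eq) auto
    thus False using q(1) insert.hyps(2) by simp
  qed
  obtain W where W: "eta_exponents W" "\<And>s. s > 0 \<Longrightarrow> eta_order W s \<ge> 0"
    "\<And>s p. s > 0 \<Longrightarrow> p \<in> Q \<Longrightarrow> multiplicity p s \<noteq> j p \<Longrightarrow> eta_order W s = 0"
    "\<And>d. W d \<noteq> 0 \<Longrightarrow> d dvd M" "W M \<noteq> 0" "eta_total W = (\<Prod>p\<in>Q. local_weight p (j p))"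
    using insert.IH[OF insert.prems[OF insertI2]] unfolding M_def by auto
  \<comment> \<open>A positive d has a unique p-part and prime-to-p part; 0 has neither and gets the
    exponent 0 that \<open>eta_exponents\<close> demands.\<close>
  define X where "X d = (if d = 0 then 0 else local_exponent p (j p) (multiplicity p d) * W (d div p ^ multiplicity p d))" for d
  have X_eq: "X (p ^ i * m) = local_exponent p (j p) i * W m" if "\<not> p dvd m" for i m
  proof -
    have "p ^ i * m \<noteq> 0" using that prime_gt_0_nat[OF p] by (auto intro: Nat.gr0I)
    thus ?thesis using prime_gt_0_nat[OF p] by (simp add: X_def multiplicity_prime_power_mult[OF p that])
  qed
  have W_dvd: "W m = 0" if "p dvd m" for m
    using W(4)[of m] pM that dvd_trans by blast
  have prod: "local_product p (j p) W X" unfolding local_product_def using X_eq W_dvd by blast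
  have X_dvd: "d dvd p ^ (j p + 1) * M" if d: "X d \<noteq> 0" for d
  proof -
    have "d > 0" using d by (auto simp: X_def intro: Nat.gr0I)
    then obtain i m where im: "d = p ^ i * m" "\<not> p dvd m" "m > 0" by (rule prime_power_decomposition[OF p])
    have nz: "local_exponent p (j p) i \<noteq> 0" "W m \<noteq> 0" using d X_eq[OF im(2)] unfolding im(1) by auto
    have "i \<le> j p + 1" using nz(1) by (auto simp: local_exponent_def split: if_splits)
    thus ?thesis unfolding im(1) using W(4)[OF nz(2)] by (intro mult_dvd_mono le_imp_power_dvd)
  qed
  have "M > 0" using pM by (auto intro: Nat.gr0I)
  hence "p ^ (j p + 1) * M > 0" using prime_gt_0_nat[OF p] by simp
  hence "finite {d. d dvd p ^ (j p + 1) * M}" by (rule finite_divisors_nat)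
  hence "finite {d. X d \<noteq> 0}" by (rule rev_finite_subset) (use X_dvd in auto)
  hence X: "eta_exponents X" by (simp add: eta_exponents_def X_def)
  obtain C where C: "\<And>k. k \<noteq> j p \<Longrightarrow> C k = 0" "C (j p) > 0"
    "\<And>k s. \<not> p dvd s \<Longrightarrow> eta_order X (p ^ k * s) = C k * eta_order W s"
    "eta_total X = local_weight p (j p) * eta_total W"
    by (rule local_product_order_total[OF p X prod]) blast
  have "eta_order X s \<ge> 0" if s: "s > 0" for s
  proof -
    obtain k r where r: "s = p ^ k * r" "\<not> p dvd r" "r > 0" by (rule prime_power_decomposition[OF p s])
    have "C k \<ge> 0" using C(1,2) by (cases "k = j p") auto
    thus ?thesis unfolding r(1) C(3)[OF r(2)] using W(2)[OF r(3)] by simp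
  qed
  moreover have "eta_order X s = 0" if s: "s > 0" and q: "q \<in> insert p Q" and mult: "multiplicity q s \<noteq> j q" for s q
  proof -
    obtain k r where r: "s = p ^ k * r" "\<not> p dvd r" "r > 0" by (rule prime_power_decomposition[OF p s])
    show ?thesis
    proof (cases "q = p")
      case True
      hence "k \<noteq> j p" using mult unfolding r(1) by (simp add: multiplicity_prime_power_mult[OF p r(2)])
      thus ?thesis unfolding r(1) C(3)[OF r(2)] using C(1) by simp
    next
      case False
      hence "multiplicity q r \<noteq> j q" "q \<in> Q"
        using mult q insert.prems multiplicity_other_prime_power[OF p, of q r k] r(3) unfolding r(1) by auto
      thus ?thesis unfolding r(1) C(3)[OF r(2)] using W(3)[OF r(3)] by simp
    qed
  qed
  moreover have "X (p ^ (j p + 1) * M) \<noteq> 0"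
    using W(5) prime_gt_0_nat[OF p] unfolding X_eq[OF pM] by (simp add: local_exponent_def)
  moreover have "(\<Prod>p\<in>insert p Q. p ^ (j p + 1)) = p ^ (j p + 1) * M"
    using insert.hyps by (simp add: M_def)
  moreover have "eta_total X = (\<Prod>p\<in>insert p Q. local_weight p (j p))"
    using insert.hyps by (simp add: C(4) W(6))
  ultimately show ?case using X X_dvd by (intro exI[of _ X]) auto
qed

text \<open>At s = 0, the cusp at infinity, gcd d 0 = d, and this is also gcd d L for the level L.
  So s = 0 and s = L give the same order.\<close>

lemma eta_order_0_nonneg:
  assumes X: "eta_exponents X" and nonneg: "\<And>s. s > 0 \<Longrightarrow> eta_order X s \<ge> 0"
  shows "eta_order X s \<ge> 0"
proof (cases "s = 0")
  case True
  define L where "L = Lcm {d. X d \<noteq> 0}"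
  have "L > 0" unfolding L_def using X by (intro Nat.gr0I) (auto simp: eta_exponents_def Lcm_0_iff)
  moreover have "gcd d L = d" if "X d \<noteq> 0" for d
    using that by (simp add: L_def gcd_proj1_iff)
  hence "eta_order X 0 = eta_order X L" unfolding cusp_order_def by (intro sum.cong) auto
  ultimately show ?thesis using nonneg[of L] True by simp
qed (use nonneg in auto)

lemma totient_prod_primes:
  assumes "finite Q" "\<And>p. p \<in> Q \<Longrightarrow> prime p"
  shows "int (totient (\<Prod>Q)) = (\<Prod>p\<in>Q. int p - 1)"
  using assms
proof (induction Q rule: finite_induct)
  case (insert p Q)
  have p: "prime p" using insert.prems by blast
  have "coprime p (\<Prod>Q)"
    using insert.prems insert.hyps by (intro prod_coprime_right) (metis insertCI primes_coprime)
  hence "totient (p * \<Prod>Q) = (p - 1) * totient (\<Prod>Q)"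
    using p by (simp add: totient_mult_coprime totient_prime)
  thus ?case using insert prime_gt_0_nat[OF p] by (simp add: of_nat_diff)
qed simp

lemma trivial_exponents_constant:
  assumes "\<And>d. X d = 0"
  shows "eta_quotient X constant_on S"
  using assms by (auto simp: eta_quotient_def constant_on_def)

lemma irreducible_if_vanishing_at_one_cusp:
  assumes Q: "finite Q" "\<And>p. p \<in> Q \<Longrightarrow> prime p" and X: "eta_exponents X"
    and nonneg: "\<And>s. s > 0 \<Longrightarrow> eta_order X s \<ge> 0"
    and zero: "\<And>s p. s > 0 \<Longrightarrow> p \<in> Q \<Longrightarrow> multiplicity p s \<noteq> j p \<Longrightarrow> eta_order X s = 0"
    and total: "eta_total X = (\<Prod>p\<in>Q. local_weight p (j p))"
  shows "irreducible_eta_quotient X"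
  unfolding irreducible_eta_quotient_def
proof (intro conjI allI impI notI)
  show "holomorphic_eta_quotient X"
    using holomorphic_eta_quotient_iff[OF X] eta_order_0_nonneg[OF X nonneg] by blast
next
  fix M assume "factorizable_on_Gamma0 M X"
  then obtain Y Z where Y: "eta_exponents Y" "holomorphic_eta_quotient Y" "\<not> eta_quotient Y constant_on upper_half_plane"
    and Z: "eta_exponents Z" "holomorphic_eta_quotient Z" "\<not> eta_quotient Z constant_on upper_half_plane"
    and eq: "\<And>z. z \<in> upper_half_plane \<Longrightarrow> eta_quotient X z = eta_quotient Y z * eta_quotient Z z"
    unfolding factorizable_on_Gamma0_def eta_quotient_on_Gamma0_def by blast
  define D where "D = (\<Prod>p\<in>Q. local_weight p (j p))"
  have D: "D > 0" unfolding D_def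
    using Q prime_gt_1_nat by (intro prod_pos) (auto simp: local_weight_def)
  have order: "eta_order X s = eta_order Y s + eta_order Z s" for s
    by (rule eta_order_mult[OF X Y(1) Z(1) eq])
  have Yn: "eta_order Y s \<ge> 0" and Zn: "eta_order Z s \<ge> 0" for s
    using Y Z holomorphic_eta_quotient_iff by auto
  have YZ0: "eta_order Y s = 0" "eta_order Z s = 0" if "s > 0" "p \<in> Q" "multiplicity p s \<noteq> j p" for s p
    using order[of s] Yn[of s] Zn[of s] zero[OF that] by linarith+
  have "D dvd eta_total Y" "D dvd eta_total Z"
    unfolding D_def by (rule local_weights_dvd_eta_total[OF Q]; use Y Z YZ0 in blast)+
  moreover have "eta_total X = eta_total Y + eta_total Z"
  proof -
    define fX where "fX = (\<lambda>d. real_of_int (X d))"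
    define fY where "fY = (\<lambda>d. real_of_int (Y d))"
    define fZ where "fZ = (\<lambda>d. real_of_int (Z d))"
    have f: "finitely_supported fX" "finitely_supported fY" "finitely_supported fZ"
      using X Y Z by (simp_all add: fX_def fY_def fZ_def finitely_supported_of_int_iff)
    define h where "h = (\<lambda>d. 1 * fY d + 1 * fZ d)"
    have h: "finitely_supported h" unfolding h_def by (intro finitely_supported_add f)
    have hp: "pairing h g = pairing fY g + pairing fZ g" for g
      unfolding h_def pairing_add[OF f(2,3)] by simp
    \<comment> \<open>Totals are not visible in the identity of functions. Additivity of the orders
      makes the exponent family X - Y - Z vanish by injectivity, and additivity of the totals
      follows.\<close>
    define e where "e = (\<lambda>d. 1 * fX d + (- 1) * h d)"
    have e: "finitely_supported e" unfolding e_def by (intro finitely_supported_add f h)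
    have ep: "pairing e g = pairing fX g - (pairing fY g + pairing fZ g)" for g
      unfolding e_def pairing_add[OF f(1) h] hp by simp
    have "e d = 0" for d
      by (rule eq_zero_if_cusp_orders_zero[OF e])
        (use order in \<open>simp add: cusp_order_conv_pairing ep fX_def fY_def fZ_def\<close>)
    hence "pairing e (\<lambda>_. 1) = 0" by (simp add: pairing_def)
    hence "real_of_int (eta_total X) = of_int (eta_total Y + eta_total Z)"
      by (simp add: ep of_int_eta_total fX_def fY_def fZ_def)
    thus ?thesis by (simp only: of_int_eq_iff)
  qed
  moreover have "eta_total V > 0"
    if V: "eta_exponents V" "\<And>s. eta_order V s \<ge> 0" "\<not> eta_quotient V constant_on upper_half_plane" for V
  proof -
    have fV: "finitely_supported (\<lambda>d. real_of_int (V d))" using V by (simp add: finitely_supported_of_int_iff)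
    have "real_of_int (eta_total V) \<ge> 0" unfolding of_int_eta_total by (rule total_nonneg(1)[OF fV V(2)])
    moreover have "eta_total V \<noteq> 0"
    proof
      assume "eta_total V = 0"
      hence "pairing (\<lambda>d. real_of_int (V d)) (\<lambda>_. 1) = 0" by (simp flip: of_int_eta_total)
      hence "real_of_int (V d) = 0" for d by (rule total_nonneg(2)[OF fV V(2)])
      thus False using V(3) trivial_exponents_constant[of V] by simp
    qed
    ultimately show ?thesis by simp
  qed
  hence "eta_total Y > 0" "eta_total Z > 0" using Y Z Yn Zn by blast+
  \<comment> \<open>Both totals are positive multiples of D, so their sum is at least 2 D, while it
    should equal D.\<close>
  ultimately show False using zdvd_imp_le[of D "eta_total Y"] zdvd_imp_le[of D "eta_total Z"] D total
    unfolding D_def by linarith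
qed

theorem theorem3:
  fixes N :: nat
  assumes "N > 0"
  shows "(\<forall>t::nat. t > 0 \<and> t dvd N div rad N \<longrightarrow>
            (\<exists>X. eta_quotient_on_Gamma0 N X \<and> irreducible_eta_quotient X \<and>
                 eta_weight X =
                   1 / 2 * real (totient (rad N)) * real (totient (rad (gcd t (N div t))))))
       \<and> (let t = N div rad N in
            \<exists>X. eta_exponents X \<and> eta_level X = N \<and> irreducible_eta_quotient X \<and>
                eta_weight X =
                  1 / 2 * real (totient (rad N)) * real (totient (rad (gcd t (N div t)))))"
proof -
  define Q where "Q = prime_factors N"
  have Q: "finite Q" "\<And>p. p \<in> Q \<Longrightarrow> prime p" by (auto simp: Q_def)
  have radN: "rad N = \<Prod>Q" by (simp add: rad_def Q_def)
  have rad_dvd: "rad N dvd N"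
  proof -
    have "\<Prod>Q dvd (\<Prod>p\<in>Q. p ^ multiplicity p N)"
      using assms by (intro prod_dvd_prod) (auto simp: Q_def prime_factors_multiplicity intro!: dvd_power)
    thus ?thesis using assms by (simp add: radN Q_def prod_prime_factors)
  qed
  have main: "\<exists>X. eta_exponents X \<and> eta_level X dvd N \<and> (t = N div rad N \<longrightarrow> eta_level X = N) \<and>
      irreducible_eta_quotient X \<and>
      eta_weight X = 1 / 2 * real (totient (rad N)) * real (totient (rad (gcd t (N div t))))"
    if t: "t > 0" "t dvd N div rad N" for t
  proof -
    define j where "j p = multiplicity p t" for p
    have N_eq: "N = rad N * (N div rad N)" using rad_dvd by simp
    have tN: "t dvd N" using t(2) N_eq by (metis dvd_mult)
    have tQ: "prime_factors t \<subseteq> Q" unfolding Q_def using tN assms by (intro dvd_prime_factors) auto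
    \<comment> \<open>Raising every exponent of t by one, including the zero exponents at primes of
      N not dividing t, multiplies t by rad N. The product is the level of the quotient, and it
      equals N for t = N / rad N.\<close>
    have "(\<Prod>p\<in>Q. p ^ (j p + 1)) = (\<Prod>p\<in>Q. p ^ j p) * \<Prod>Q" by (simp add: prod.distrib mult.commute)
    also have "(\<Prod>p\<in>Q. p ^ j p) = (\<Prod>p\<in>prime_factors t. p ^ j p)"
      using tQ Q by (intro prod.mono_neutral_right)
        (auto simp: j_def prime_factors_multiplicity)
    also have "\<dots> = t" using t(1) by (simp add: j_def prod_prime_factors)
    finally have top: "(\<Prod>p\<in>Q. p ^ (j p + 1)) = t * rad N" by (simp add: radN)
    obtain X where X: "eta_exponents X" "\<And>s. s > 0 \<Longrightarrow> eta_order X s \<ge> 0"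
      "\<And>s p. s > 0 \<Longrightarrow> p \<in> Q \<Longrightarrow> multiplicity p s \<noteq> j p \<Longrightarrow> eta_order X s = 0"
      "\<And>d. X d \<noteq> 0 \<Longrightarrow> d dvd t * rad N" "X (t * rad N) \<noteq> 0" "eta_total X = (\<Prod>p\<in>Q. local_weight p (j p))"
      using exists_eta_quotient_vanishing_at_one_cusp[OF Q, of j] unfolding top by auto
    have irr: "irreducible_eta_quotient X"
      by (rule irreducible_if_vanishing_at_one_cusp[OF Q X(1,2,3,6)])
    have level: "eta_level X = t * rad N"
    proof (rule dvd_antisym)
      show "eta_level X dvd t * rad N" unfolding eta_level_def using X(4) by (auto intro: Lcm_least)
      show "t * rad N dvd eta_level X" unfolding eta_level_def using X(5) by (auto intro: dvd_Lcm)
    qed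
    have dvd: "t * rad N dvd N" using t(2) N_eq by (metis mult.commute mult_dvd_mono dvd_refl)
    have top_level: "t = N div rad N \<longrightarrow> t * rad N = N" using N_eq by (simp add: mult.commute)
    \<comment> \<open>Since t divides N / rad N, every prime of N still divides N / t. The primes of
      the gcd are therefore those with j p nonzero, the ones that contribute a second factor p - 1
      to \<open>local_weight\<close>.\<close>
    have "prime_factors (gcd t (N div t)) = {p \<in> Q. j p \<noteq> 0}"
    proof -
      have "p dvd N div t" if "p \<in> Q" for p
      proof -
        obtain c where c: "N div rad N = t * c" using t(2) by (elim dvdE)
        have "N = t * (rad N * c)" using N_eq c by (simp add: mult_ac)
        hence "N div t = rad N * c" using t(1) by (metis nonzero_mult_div_cancel_left less_irrefl)
        moreover have "p dvd rad N" using dvd_prodI[OF Q(1) that, of "\<lambda>p. p"] by (simp add: radN)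
        ultimately show ?thesis by simp
      qed
      moreover have "j p \<noteq> 0 \<longleftrightarrow> p dvd t" if "p \<in> Q" for p
        using prime_elem_multiplicity_eq_zero_iff[of p t] Q(2)[OF that] t(1) by (simp add: j_def)
      moreover have "p \<in> Q" if "p dvd t" "prime p" for p
        using subsetD[OF tQ, of p] that t(1) by (simp add: in_prime_factors_iff)
      moreover have "gcd t (N div t) \<noteq> 0" using t(1) by simp
      ultimately show ?thesis using Q(2) by (fastforce simp: in_prime_factors_iff)
    qed
    hence "int (totient (rad (gcd t (N div t)))) = (\<Prod>p\<in>{p \<in> Q. j p \<noteq> 0}. int p - 1)"
      using totient_prod_primes[of "{p \<in> Q. j p \<noteq> 0}"] Q by (simp add: rad_def)
    also have "\<dots> = (\<Prod>p\<in>Q. if j p = 0 then 1 else int p - 1)"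
      using Q(1) by (intro prod.mono_neutral_cong_left) auto
    finally have "eta_total X = int (totient (rad N)) * int (totient (rad (gcd t (N div t))))"
      using totient_prod_primes[OF Q] by (simp add: X(6) radN local_weight_def prod.distrib)
    hence "eta_weight X = 1 / 2 * real (totient (rad N)) * real (totient (rad (gcd t (N div t))))"
      by (simp add: eta_weight_conv_total)
    thus ?thesis using X(1) irr dvd top_level unfolding level [symmetric] by blast
  qed
  have "N div rad N > 0" using rad_dvd assms by (simp add: dvd_div_eq_0_iff neq0_conv[symmetric] del: neq0_conv)
  with main[of "N div rad N"] main show ?thesis
    unfolding Let_def eta_quotient_on_Gamma0_def by auto
qed

end
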